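(* Let $A=\langle a_1,\dots,a_n\rangle$ be an automata algebra of exponential growth over a (nonzero) commutative ring $\Phi$ with identity. Let $A^{\sim}$ be the Lie algebra generated by $a_1,\dots,a_n$ inside $A$ with respect to the operation $[x,y]=xy-yx$. Then the Lie algebra $A^{\sim}$ contains a free Lie subalgebra on two free generators.
   Context: An associative $\Phi$-algebra $A$ with a fixed finite generating set $a_1,\dots,a_n$ is monomial if it has a set of defining relations of the form $c=0$, where each $c$ is a word in $a_1,\dots,a_n$; then the nonzero words in the generators form a $\Phi$-basis of $A$. A monomial algebra is called an automata algebra if the set of its nonzero words in the generators is a regular language (i.e. is accepted by a finite automaton). The growth function $V_A(m)$ is the dimension (rank) of the span of the words of length $\le m$ in the generators, i.e. for a monomial algebra the number of nonzero words of length $\le m$; $A$ has exponential growth if $V_A(m)$ grows exponentially in $m$. *)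

theory Defs
  imports Complex_Main "HOL-Library.Poly_Mapping"
begin

section \<open>Associative algebras over a commutative ring\<close>

text \<open>
  The type \<open>'a\<close> is an associative algebra, not assumed to be unital, over the nonzero
  commutative unital ring \<open>'r\<close>.
\<close>

locale assoc_algebra = module scale
  for scale :: "'r::comm_ring_1 \<Rightarrow> 'a::ring \<Rightarrow> 'a" +
  assumes scale_mult_left: "scale r x * y = scale r (x * y)"
    and scale_mult_right: "x * scale r y = scale r (x * y)"

definition is_subalgebra :: "('r::comm_ring_1 \<Rightarrow> 'a::ring \<Rightarrow> 'a) \<Rightarrow> 'a set \<Rightarrow> bool" where
  "is_subalgebra scale B \<longleftrightarrow> module.subspace scale B \<and> (\<forall>x\<in>B. \<forall>y\<in>B. x * y \<in> B)"

definition two_sided_ideal :: "'a::ring_1 set \<Rightarrow> bool" where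
  "two_sided_ideal I \<longleftrightarrow> 0 \<in> I \<and> (\<forall>x\<in>I. \<forall>y\<in>I. x + y \<in> I) \<and> (\<forall>x\<in>I. \<forall>r. r * x \<in> I \<and> x * r \<in> I)"

section \<open>Free algebras and monomial algebras\<close>

text \<open>
  Words form a monoid under concatenation, written additively because the convolution product on
  \<open>_ \<Rightarrow>\<^sub>0 _\<close> expects an additive monoid.  Thus \<open>'n list \<Rightarrow>\<^sub>0 'r\<close> is the free unital associative
  \<open>'r\<close>-algebra on \<open>'n\<close>, the word \<open>w\<close> being \<open>Poly_Mapping.single w 1\<close>.
\<close>

instantiation list :: (type) monoid_add
begin

definition zero_list :: "'a list" where "zero_list = []"

definition plus_list :: "'a list \<Rightarrow> 'a list \<Rightarrow> 'a list" where "plus_list u v = u @ v"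

instance
  by standard (auto simp: zero_list_def plus_list_def)

end

text \<open>
  The value of a nonempty word in the generators \<open>a\<close>.  The empty word has no value in an algebra
  without unit; the dummy value \<open>0\<close> is never relevant, as only nonempty words are considered below.
\<close>

fun word_val :: "('n \<Rightarrow> 'a::ring) \<Rightarrow> 'n list \<Rightarrow> 'a" where
  "word_val a [] = 0"
| "word_val a [i] = a i"
| "word_val a (i # j # w) = a i * word_val a (j # w)"

definition free_alg_eval ::
    "('r::comm_ring_1 \<Rightarrow> 'a::ring \<Rightarrow> 'a) \<Rightarrow> ('n \<Rightarrow> 'a) \<Rightarrow> ('n list \<Rightarrow>\<^sub>0 'r) \<Rightarrow> 'a" where
  "free_alg_eval scale a p = (\<Sum>w\<in>Poly_Mapping.keys p. scale (Poly_Mapping.lookup p w) (word_val a w))"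

text \<open>
  The free algebra without unit is the set of the \<open>p\<close> with \<open>Poly_Mapping.lookup p [] = 0\<close>.
  \<open>A\<close> is generated by the family \<open>a\<close>, and the kernel of the canonical map from the free algebra
  without unit onto \<open>A\<close> is the ideal generated by a set \<open>C\<close> of words.  (For a set of nonempty words,
  the ideals generated in the free algebra with and without unit coincide.)  \<open>A\<close> may be the whole
  type; letting it be a subalgebra also covers generation in the unital sense, by taking for \<open>A\<close>
  the span of the nonempty words.
\<close>

definition monomial_algebra ::
    "('r::comm_ring_1 \<Rightarrow> 'a::ring \<Rightarrow> 'a) \<Rightarrow> 'a set \<Rightarrow> ('n::finite \<Rightarrow> 'a) \<Rightarrow> bool" where
  "monomial_algebra scale A a \<longleftrightarrow>
     assoc_algebra scale \<and>
     A = is_subalgebra scale hull (range a) \<and>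
     (\<exists>C. [] \<notin> C \<and>
        {p. Poly_Mapping.lookup p [] = 0 \<and> free_alg_eval scale a p = 0} =
        two_sided_ideal hull ((\<lambda>c. Poly_Mapping.single c 1) ` C))"

definition nonzero_words :: "('n \<Rightarrow> 'a::ring) \<Rightarrow> 'n list set" where
  "nonzero_words a = {w. w \<noteq> [] \<and> word_val a w \<noteq> 0}"

section \<open>Automata algebras and growth\<close>

definition regular_language :: "'n::finite list set \<Rightarrow> bool" where
  "regular_language L \<longleftrightarrow>
     (\<exists>(Q :: nat set) (\<delta> :: nat \<Rightarrow> 'n \<Rightarrow> nat) q\<^sub>0 F.
        finite Q \<and> q\<^sub>0 \<in> Q \<and> F \<subseteq> Q \<and> (\<forall>q\<in>Q. \<forall>i. \<delta> q i \<in> Q) \<and>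
        L = {w. foldl \<delta> q\<^sub>0 w \<in> F})"

definition automata_algebra ::
    "('r::comm_ring_1 \<Rightarrow> 'a::ring \<Rightarrow> 'a) \<Rightarrow> 'a set \<Rightarrow> ('n::finite \<Rightarrow> 'a) \<Rightarrow> bool" where
  "automata_algebra scale A a \<longleftrightarrow> monomial_algebra scale A a \<and> regular_language (nonzero_words a)"

text \<open>
  The growth function of a monomial algebra: its nonzero words form a basis, so the rank of the span
  of the words of length at most \<open>m\<close> is the number of nonzero words among them.
\<close>

definition growth :: "('n::finite \<Rightarrow> 'a::ring) \<Rightarrow> nat \<Rightarrow> nat" where
  "growth a m = card {w \<in> nonzero_words a. length w \<le> m}"

text \<open>
  An exponential upper bound always holds, as there are at most \<open>\<Sum>k\<le>m. CARD('n) ^ k\<close> words of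
  length at most \<open>m\<close>.
\<close>

definition exponential_growth :: "('n::finite \<Rightarrow> 'a::ring) \<Rightarrow> bool" where
  "exponential_growth a \<longleftrightarrow> (\<exists>c>1. \<forall>\<^sub>F m in sequentially. c ^ m \<le> real (growth a m))"

section \<open>Lie algebras\<close>

locale lie_algebra = module scale
  for scale :: "'r::comm_ring_1 \<Rightarrow> 'l::ab_group_add \<Rightarrow> 'l" +
  fixes br :: "'l \<Rightarrow> 'l \<Rightarrow> 'l"
  assumes br_add_left: "br (x + y) z = br x z + br y z"
    and br_add_right: "br z (x + y) = br z x + br z y"
    and br_scale_left: "br (scale r x) y = scale r (br x y)"
    and br_scale_right: "br x (scale r y) = scale r (br x y)"
    and br_self: "br x x = 0"
    and jacobi: "br x (br y z) + br y (br z x) + br z (br x y) = 0"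

definition commutator :: "'a::ring \<Rightarrow> 'a \<Rightarrow> 'a" where
  "commutator x y = x * y - y * x"

lemma (in assoc_algebra) lie_algebra_commutator: "lie_algebra scale commutator"
  by unfold_locales
    (simp_all add: commutator_def algebra_simps scale_mult_left scale_mult_right scale_right_diff_distrib)

definition is_lie_subalgebra ::
    "('r::comm_ring_1 \<Rightarrow> 'l::ab_group_add \<Rightarrow> 'l) \<Rightarrow> ('l \<Rightarrow> 'l \<Rightarrow> 'l) \<Rightarrow> 'l set \<Rightarrow> bool" where
  "is_lie_subalgebra scale br L \<longleftrightarrow> module.subspace scale L \<and> (\<forall>x\<in>L. \<forall>y\<in>L. br x y \<in> L)"

section \<open>Free Lie algebras\<close>

text \<open>
  The free Lie algebra over \<open>'r\<close> on \<open>'x\<close> is the set of formal Lie expressions modulo the congruence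
  generated by the axioms of Lie algebras over \<open>'r\<close>.
\<close>

datatype ('r, 'x) lie_term =
    LVar 'x
  | LZero
  | LAdd "('r, 'x) lie_term" "('r, 'x) lie_term"
  | LScale 'r "('r, 'x) lie_term"
  | LBr "('r, 'x) lie_term" "('r, 'x) lie_term"

inductive lie_eq :: "('r::comm_ring_1, 'x) lie_term \<Rightarrow> ('r, 'x) lie_term \<Rightarrow> bool" where
  refl: "lie_eq s s"
| sym: "lie_eq s t \<Longrightarrow> lie_eq t s"
| trans: "lie_eq s t \<Longrightarrow> lie_eq t u \<Longrightarrow> lie_eq s u"
| cong_add: "lie_eq s s' \<Longrightarrow> lie_eq t t' \<Longrightarrow> lie_eq (LAdd s t) (LAdd s' t')"
| cong_scale: "lie_eq s s' \<Longrightarrow> lie_eq (LScale r s) (LScale r s')"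
| cong_br: "lie_eq s s' \<Longrightarrow> lie_eq t t' \<Longrightarrow> lie_eq (LBr s t) (LBr s' t')"
| add_assoc: "lie_eq (LAdd (LAdd s t) u) (LAdd s (LAdd t u))"
| add_commute: "lie_eq (LAdd s t) (LAdd t s)"
| add_zero: "lie_eq (LAdd LZero s) s"
| add_neg: "lie_eq (LAdd s (LScale (- 1) s)) LZero"
| scale_add_right: "lie_eq (LScale r (LAdd s t)) (LAdd (LScale r s) (LScale r t))"
| scale_add_left: "lie_eq (LScale (r + q) s) (LAdd (LScale r s) (LScale q s))"
| scale_scale: "lie_eq (LScale r (LScale q s)) (LScale (r * q) s)"
| scale_one: "lie_eq (LScale 1 s) s"
| br_add_left: "lie_eq (LBr (LAdd s t) u) (LAdd (LBr s u) (LBr t u))"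
| br_add_right: "lie_eq (LBr u (LAdd s t)) (LAdd (LBr u s) (LBr u t))"
| br_scale_left: "lie_eq (LBr (LScale r s) t) (LScale r (LBr s t))"
| br_scale_right: "lie_eq (LBr s (LScale r t)) (LScale r (LBr s t))"
| br_self: "lie_eq (LBr s s) LZero"
| jacobi: "lie_eq (LAdd (LAdd (LBr s (LBr t u)) (LBr t (LBr u s))) (LBr u (LBr s t))) LZero"

primrec lie_eval ::
    "('r \<Rightarrow> 'l::ab_group_add \<Rightarrow> 'l) \<Rightarrow> ('l \<Rightarrow> 'l \<Rightarrow> 'l) \<Rightarrow> ('x \<Rightarrow> 'l) \<Rightarrow> ('r, 'x) lie_term \<Rightarrow> 'l" where
  "lie_eval scale br g (LVar x) = g x"
| "lie_eval scale br g LZero = 0"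
| "lie_eval scale br g (LAdd s t) = lie_eval scale br g s + lie_eval scale br g t"
| "lie_eval scale br g (LScale r s) = scale r (lie_eval scale br g s)"
| "lie_eval scale br g (LBr s t) = br (lie_eval scale br g s) (lie_eval scale br g t)"

text \<open>
  \<open>L\<close> is the Lie subalgebra generated by the family \<open>g\<close>, and the canonical homomorphism onto \<open>L\<close>
  from the free Lie algebra on the index type of \<open>g\<close> is injective.
\<close>

definition free_lie_subalgebra ::
    "('r::comm_ring_1 \<Rightarrow> 'l::ab_group_add \<Rightarrow> 'l) \<Rightarrow> ('l \<Rightarrow> 'l \<Rightarrow> 'l) \<Rightarrow> 'l set \<Rightarrow> ('x \<Rightarrow> 'l) \<Rightarrow> bool" where
  "free_lie_subalgebra scale br L g \<longleftrightarrow>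
     L = is_lie_subalgebra scale br hull (range g) \<and>
     (\<forall>s t. lie_eval scale br g s = lie_eval scale br g t \<longrightarrow> lie_eq s t)"

lemma (in lie_algebra) lie_eval_eq:
  assumes "lie_eq s t"
  shows "lie_eval scale br g s = lie_eval scale br g t"
  using assms
  by induction
    (simp_all add: br_add_left br_add_right br_scale_left br_scale_right br_self jacobi[unfolded add.assoc]
      scale_right_distrib scale_left_distrib add_ac)

lemma (in lie_algebra) lie_hull_eq_range:
  "is_lie_subalgebra scale br hull (range g) = range (lie_eval scale br g)" (is "?H = ?R")
proof
  have "0 \<in> ?R"
    by (metis lie_eval.simps(2) rangeI)
  moreover have "x + y \<in> ?R" "br x y \<in> ?R" if "x \<in> ?R" "y \<in> ?R" for x y
    using that by (auto simp flip: lie_eval.simps)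
  moreover have "scale r x \<in> ?R" if "x \<in> ?R" for r x
    using that by (auto simp flip: lie_eval.simps)
  ultimately have "is_lie_subalgebra scale br ?R"
    by (auto simp: is_lie_subalgebra_def subspace_def)
  moreover have "range g \<subseteq> ?R"
    by (metis image_subsetI lie_eval.simps(1) rangeI)
  ultimately show "?H \<subseteq> ?R"
    by (rule hull_minimal[rotated])
  have "lie_eval scale br g s \<in> B" if B: "is_lie_subalgebra scale br B" "range g \<subseteq> B" for B s
    using B by (induction s) (auto simp: is_lie_subalgebra_def subspace_def)
  then show "?R \<subseteq> ?H"
    by (auto simp: hull_def)
qed

text \<open>The universal property of free Lie algebras.\<close>

lemma free_lie_subalgebra_universal:
  assumes L: "lie_algebra scale br" and M: "lie_algebra scale' br'"
    and free: "free_lie_subalgebra scale br L g"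
  shows "\<exists>\<phi>. (\<forall>i. \<phi> (g i) = h i) \<and>
    (\<forall>x\<in>L. \<forall>y\<in>L. \<phi> (x + y) = \<phi> x + \<phi> y \<and> \<phi> (br x y) = br' (\<phi> x) (\<phi> y)) \<and>
    (\<forall>r. \<forall>x\<in>L. \<phi> (scale r x) = scale' r (\<phi> x))"
proof -
  interpret L: lie_algebra scale br by (fact L)
  interpret M: lie_algebra scale' br' by (fact M)
  let ?e = "lie_eval scale br g" and ?e' = "lie_eval scale' br' h"
  define \<phi> where "\<phi> x = ?e' (SOME s. ?e s = x)" for x
  have phi: "\<phi> (?e s) = ?e' s" for s
  proof -
    have "?e (SOME t. ?e t = ?e s) = ?e s"
      by (rule someI) (rule HOL.refl)
    then show ?thesis
      using free unfolding \<phi>_def free_lie_subalgebra_def by (metis M.lie_eval_eq)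
  qed
  have LR: "L = range ?e"
    using free by (simp add: free_lie_subalgebra_def L.lie_hull_eq_range)
  have "\<phi> (g i) = h i" for i
    using phi[of "LVar i"] by simp
  moreover have "\<phi> (?e s + ?e t) = \<phi> (?e s) + \<phi> (?e t)"
      "\<phi> (br (?e s) (?e t)) = br' (\<phi> (?e s)) (\<phi> (?e t))" for s t
    using phi[of "LAdd s t"] phi[of "LBr s t"] by (simp_all add: phi)
  moreover have "\<phi> (scale r (?e s)) = scale' r (\<phi> (?e s))" for r s
    using phi[of "LScale r s"] by (simp add: phi)
  ultimately show ?thesis
    unfolding LR by (intro exI[of _ \<phi>]) auto
qed

end

theory Submission
  imports Defs
begin

text \<open>
  The proof compares leading words.  Regard words over the generators as numbers in base \<open>B\<close>, and say
  that \<open>x\<close> is led by the word \<open>w\<close> if \<open>x - w\<close> is a combination of smaller words of the same length.  If \<open>x\<close>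
  and \<open>y\<close> are led by \<open>u\<close> and \<open>v\<close>, and \<open>v @ u\<close> is smaller than \<open>u @ v\<close>, then \<open>x y - y x\<close> is led by \<open>u @ v\<close> with
  coefficient one (\<open>leads_commutator\<close>).  So every Lyndon word leads an element of the Lie algebra
  generated by the letters.  Because the coefficient is one and the nonzero words of a monomial algebra
  are linearly independent (\<open>nonzero_word_independent\<close>), elements with distinct nonzero leading words are
  linearly independent over any commutative ring.

  An automaton accepting exponentially many words has a state \<open>q\<close>, on some accepting path, with two
  distinct loops \<open>u\<close>, \<open>v\<close> of equal length which are moreover maximal among their rotations
  (\<open>exponential_language_has_two_loops\<close>).  After exchanging \<open>u\<close> and \<open>v\<close> if necessary, \<open>u u v\<close> and
  \<open>u v v\<close> are distinct Lyndon words of the same length (\<open>lyndon_pair\<close>), and all products of them are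
  loops at \<open>q\<close>, hence nonzero.  Choose elements of the Lie algebra led by these two words.

  The two elements generate a free Lie algebra.  Every Lie expression is congruent to a combination of
  Hall trees, the standard bracketings of Lyndon words (\<open>br_hall\<close>), and a Lyndon word has only one such
  bracketing (\<open>hall_unique\<close>).  Because the two chosen words have equal length, substituting
  them for two letters preserves the order of words.  The values of the Hall trees are thus led by the
  substituted words, which are distinct and nonzero, so these values are linearly independent and a Lie
  expression with value zero is congruent to zero (\<open>lie_eq_if_hall_independent\<close>).

  All comparisons of words go through the slope, the value of \<open>w\<close> divided by \<open>B ^ length w - 1\<close>: the word
  \<open>v @ u\<close> is smaller than \<open>u @ v\<close> if and only if \<open>v\<close> has smaller slope than \<open>u\<close> (\<open>val_swap_less_iff\<close>), and the slope of
  \<open>u @ v\<close> is a proper convex combination of those of \<open>u\<close> and \<open>v\<close> (\<open>slope_append_convex\<close>).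
\<close>

section \<open>Words as numbers\<close>

locale digits =
  fixes c :: "'x \<Rightarrow> nat" and B :: nat
  assumes base: "2 \<le> B" and inj_digit: "inj c" and digit_less: "c x < B"
begin

primrec val :: "'x list \<Rightarrow> nat" where
  "val [] = 0"
| "val (x # w) = c x * B ^ length w + val w"

text \<open>
  The number whose expansion in base \<open>B\<close> is \<open>0.www\<dots>\<close>.  Slopes make words of different lengths
  comparable and turn the combinatorics of Lyndon words into statements about convex combinations.
\<close>

definition slope :: "'x list \<Rightarrow> real" where
  "slope w = real (val w) / (real B ^ length w - 1)"

lemma val_append: "val (u @ v) = val u * B ^ length v + val v"
  by (induction u) (simp_all add: algebra_simps power_add)

lemma val_less: "val w < B ^ length w"
proof (induction w)
  case (Cons x w)
  have "c x * B ^ length w + val w < (c x + 1) * B ^ length w"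
    using Cons by simp
  also have "\<dots> \<le> B * B ^ length w"
    using digit_less[of x] by (intro mult_right_mono) auto
  finally show ?case by simp
qed simp

lemma val_inj: "length u = length v \<Longrightarrow> val u = val v \<Longrightarrow> u = v"
proof (induction u v rule: list_induct2)
  case (Cons x u y v)
  define m where "m = B ^ length v"
  have eq: "c x * m + val u = c y * m + val v" and less: "val u < m" "val v < m"
    using Cons val_less[of u] val_less[of v] by (simp_all add: m_def)
  have "(c x * m + val u) div m = c x" "(c y * m + val v) div m = c y"
    using less by simp_all
  then have "c x = c y"
    using eq by simp
  then show ?case
    using eq Cons.IH inj_digit by (simp add: inj_eq)
qed simp

lemma power_base_gt_1: "w \<noteq> [] \<Longrightarrow> 1 < real B ^ length w"
  using base by (intro one_less_power) auto

text \<open>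
  With \<open>p\<close>, \<open>q\<close> the powers of \<open>B\<close> belonging to \<open>u\<close>, \<open>v\<close>, the weights are \<open>q (p - 1) / (p q - 1)\<close> and
  \<open>(q - 1) / (p q - 1)\<close>.  This is what makes slopes manageable: appending averages.
\<close>

lemma slope_append_convex:
  assumes "u \<noteq> []" "v \<noteq> []"
  obtains \<alpha> \<beta> where "0 < \<alpha>" "0 < \<beta>" "\<alpha> + \<beta> = 1" "slope (u @ v) = \<alpha> * slope u + \<beta> * slope v"
proof -
  define p q where "p = real B ^ length u" and "q = real B ^ length v"
  have pq: "1 < p" "1 < q"
    using assms power_base_gt_1 by (auto simp: p_def q_def)
  have pq1: "1 < p * q"
    using pq by (simp add: less_1_mult)
  have "real (val (u @ v)) = real (val u) * q + real (val v)"
    by (simp add: val_append q_def)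
  moreover have "real (val u) = slope u * (p - 1)" "real (val v) = slope v * (q - 1)"
    using pq by (simp_all add: slope_def p_def q_def)
  moreover have "slope (u @ v) = real (val (u @ v)) / (p * q - 1)"
    by (simp add: slope_def p_def q_def power_add)
  ultimately have "slope (u @ v) = q * (p - 1) / (p * q - 1) * slope u + (q - 1) / (p * q - 1) * slope v"
    by (simp add: algebra_simps flip: add_divide_distrib)
  moreover have "q * (p - 1) / (p * q - 1) + (q - 1) / (p * q - 1) = 1"
    using pq1 by (simp add: divide_simps) (simp add: algebra_simps)
  ultimately show ?thesis
    using that[of "q * (p - 1) / (p * q - 1)" "(q - 1) / (p * q - 1)"] pq pq1 by simp
qed

lemma slope_append:
  assumes "u \<noteq> []" "v \<noteq> []"
  shows slope_append_less_left: "slope (u @ v) < slope u \<longleftrightarrow> slope v < slope u"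
    and slope_append_less_right: "slope v < slope (u @ v) \<longleftrightarrow> slope v < slope u"
    and slope_append_le_left: "slope (u @ v) \<le> slope u \<longleftrightarrow> slope v \<le> slope u"
    and slope_append_le_right: "slope v \<le> slope (u @ v) \<longleftrightarrow> slope v \<le> slope u"
proof -
  obtain \<alpha> \<beta> where ab: "0 < \<alpha>" "0 < \<beta>" "\<alpha> + \<beta> = 1"
    and eq: "slope (u @ v) = \<alpha> * slope u + \<beta> * slope v"
    using slope_append_convex[OF assms] .
  have "slope u = \<alpha> * slope u + \<beta> * slope u" "slope v = \<alpha> * slope v + \<beta> * slope v"
    using ab(3) by (metis distrib_right mult_1)+
  then have 1: "slope u - slope (u @ v) = \<beta> * (slope u - slope v)"
    and 2: "slope (u @ v) - slope v = \<alpha> * (slope u - slope v)"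
    unfolding eq right_diff_distrib by linarith+
  show "slope (u @ v) < slope u \<longleftrightarrow> slope v < slope u"
    "slope (u @ v) \<le> slope u \<longleftrightarrow> slope v \<le> slope u"
    using 1 ab zero_less_mult_iff[of \<beta> "slope u - slope v"] zero_le_mult_iff[of \<beta> "slope u - slope v"]
    by linarith+
  show "slope v < slope (u @ v) \<longleftrightarrow> slope v < slope u"
    "slope v \<le> slope (u @ v) \<longleftrightarrow> slope v \<le> slope u"
    using 2 ab zero_less_mult_iff[of \<alpha> "slope u - slope v"] zero_le_mult_iff[of \<alpha> "slope u - slope v"]
    by linarith+
qed

lemma slope_append_eq:
  assumes "u \<noteq> []" "v \<noteq> []" "slope u = slope v"
  shows "slope (u @ v) = slope u"
  using slope_append_le_left[OF assms(1,2)] slope_append_le_right[OF assms(1,2)] assms(3) by simp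

lemma val_swap_less_iff:
  assumes "u \<noteq> []" "v \<noteq> []"
  shows "val (v @ u) < val (u @ v) \<longleftrightarrow> slope v < slope u"
proof -
  define p q where "p = real B ^ length u" and "q = real B ^ length v"
  have pq: "1 < p" "1 < q"
    using assms power_base_gt_1 by (auto simp: p_def q_def)
  have "val (v @ u) < val (u @ v) \<longleftrightarrow> real (val (v @ u)) < real (val (u @ v))"
    by simp
  also have "\<dots> \<longleftrightarrow> real (val v) * p + real (val u) < real (val u) * q + real (val v)"
    by (simp add: val_append p_def q_def)
  also have "\<dots> \<longleftrightarrow> real (val v) * (p - 1) < real (val u) * (q - 1)"
    by (auto simp: algebra_simps)
  also have "\<dots> \<longleftrightarrow> slope v < slope u"
    using pq by (simp add: slope_def p_def q_def divide_simps)
  finally show ?thesis .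
qed

section \<open>Lyndon words\<close>

text \<open>
  These are the Lyndon words with respect to the reversed order: the words that are strictly larger
  than all their nontrivial rotations.  The inductive form is chosen because each step \<open>u @ v\<close> is
  matched by a commutator, whose leading word is \<open>u @ v\<close> exactly when \<open>v @ u\<close> is the smaller word.
\<close>

inductive lyndon :: "'x list \<Rightarrow> bool" where
  letter: "lyndon [x]"
| append: "lyndon u \<Longrightarrow> lyndon v \<Longrightarrow> slope v < slope u \<Longrightarrow> lyndon (u @ v)"

lemma lyndon_nonempty: "lyndon w \<Longrightarrow> w \<noteq> []"
  by (induction rule: lyndon.induct) auto

text \<open>
  The property by which Lyndon words are usually defined: \<open>q @ p\<close> is smaller than \<open>p @ q\<close>, that is,
  \<open>q\<close> has smaller slope than \<open>p\<close>.  A cut inside one constituent of \<open>w\<close> satisfies this inequality within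
  the constituent, and averaging with the other constituent preserves it.
\<close>

lemma lyndon_split_slope:
  assumes "lyndon w" "w = p @ q" "p \<noteq> []" "q \<noteq> []"
  shows "slope q < slope p"
  using assms
proof (induction arbitrary: p q rule: lyndon.induct)
  case (letter x)
  then show ?case by (auto simp: Cons_eq_append_conv)
next
  case (append u v)
  have ne: "u \<noteq> []" "v \<noteq> []"
    using append.hyps lyndon_nonempty by auto
  from append.prems(1) consider (left) r where "u = p @ r" "q = r @ v" "r \<noteq> []"
    | (mid) "u = p" "v = q" | (right) r where "p = u @ r" "v = r @ q" "r \<noteq> []"
    by (auto simp: append_eq_append_conv2)
  then show ?case
  proof cases
    case left
    have r: "slope r < slope p"
      using append.IH(1) left append.prems by blast
    have "slope u < slope p"
      using left r slope_append_less_left append.prems by blast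
    moreover from this have "slope v < slope p"
      using append.hyps(3) by simp
    ultimately show ?thesis
      using r left ne slope_append_less_left slope_append_less_right
      by (smt (verit) slope_append_convex convex_bound_lt)
  next
    case mid
    then show ?thesis using append by simp
  next
    case right
    have q: "slope q < slope r"
      using append.IH(2) right append.prems by blast
    then have qv: "slope q < slope v"
      using right slope_append_less_right append.prems by blast
    show ?thesis
    proof (cases "slope r \<le> slope u")
      case True
      then have "slope r \<le> slope p"
        using right ne slope_append_le_right by blast
      then show ?thesis using q by simp
    next
      case False
      then have "slope u < slope p"
        using right ne slope_append_le_left[of u r] by simp
      then show ?thesis using qv append.hyps(3) by simp
    qed
  qed
qed

lemma lyndon_suffix_slope:
  assumes "lyndon (p @ q)" "p \<noteq> []" "q \<noteq> []"
  shows "slope q < slope (p @ q)"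
  using lyndon_split_slope[OF assms(1) HOL.refl assms(2,3)] assms slope_append_less_right by blast

lemma slope_eq_imp_commute:
  assumes "u \<noteq> []" "v \<noteq> []" "slope u = slope v"
  shows "u @ v = v @ u"
  using val_swap_less_iff[of u v] val_swap_less_iff[of v u] assms by (intro val_inj) auto

text \<open>
  Words of equal slope commute, so the shorter of the two is a suffix of the longer; a proper suffix of
  a Lyndon word has smaller slope.
\<close>

lemma lyndon_eq_if_slope_eq:
  assumes "lyndon u" "lyndon v" "slope u = slope v"
  shows "u = v"
proof -
  have *: "u = v" if uv: "lyndon u" "lyndon v" "slope u = slope v" "length u \<le> length v" for u v
  proof -
    have ne: "u \<noteq> []" "v \<noteq> []"
      using uv lyndon_nonempty by auto
    have "u @ v = v @ u"
      using slope_eq_imp_commute uv ne by blast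
    then obtain p where p: "v = p @ u"
      using uv(4) by (metis append_eq_append_conv_if append_take_drop_id)
    show ?thesis
      using lyndon_suffix_slope[of p u] uv p ne by auto
  qed
  show ?thesis
    using *[of u v] *[of v u] assms by fastforce
qed

lemma slope_le_slope_concat:
  assumes "ls \<noteq> []" "\<forall>l\<in>set ls. l \<noteq> [] \<and> s \<le> slope l"
  shows "s \<le> slope (concat ls)"
  using assms
proof (induction ls rule: list_nonempty_induct)
  case (cons l ls)
  then have "concat ls \<noteq> []" "l \<noteq> []" "s \<le> slope l" "s \<le> slope (concat ls)"
    by (auto simp: neq_Nil_conv)
  then show ?case
    using slope_append_le_left[of l "concat ls"] slope_append_le_right[of l "concat ls"] by fastforce
qed simp

lemma slope_eq_if_slope_concat_le:
  assumes "ls \<noteq> []" "\<forall>l\<in>set ls. l \<noteq> [] \<and> s \<le> slope l" "slope (concat ls) \<le> s" "l \<in> set ls"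
  shows "slope l = s"
  using assms
proof (induction ls rule: list_nonempty_induct)
  case (cons k ls)
  then have ne: "concat ls \<noteq> []" "k \<noteq> []" and le: "s \<le> slope k" "s \<le> slope (concat ls)"
    using slope_le_slope_concat[of ls s] by (auto simp: neq_Nil_conv)
  have "slope k \<le> s" "slope (concat ls) \<le> s"
    using slope_append[OF ne(2,1)] cons.prems(2) le by fastforce+
  then show ?case
    using cons le by auto
qed simp

text \<open>
  The Chen--Fox--Lyndon factorization.  Adding a letter in front may create descents of the slope, and
  each descent is removed by merging the two factors into one Lyndon word.
\<close>

lemma lyndon_factorization:
  "\<exists>ls. concat ls = w \<and> (\<forall>l\<in>set ls. lyndon l) \<and> sorted (map slope ls)"
proof (induction w)
  case Nil
  then show ?case by (intro exI[of _ "[]"]) simp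
next
  case (Cons x w)
  have merge: "\<exists>ms. concat ms = u @ concat ls \<and> (\<forall>l\<in>set ms. lyndon l) \<and> sorted (map slope ms)"
    if "lyndon u" "\<forall>l\<in>set ls. lyndon l" "sorted (map slope ls)" for u ls
    using that
  proof (induction ls arbitrary: u)
    case Nil
    then show ?case by (intro exI[of _ "[u]"]) simp
  next
    case (Cons l ls)
    show ?case
    proof (cases "slope l < slope u")
      case True
      then have "lyndon (u @ l)"
        using Cons.prems by (simp add: lyndon.append)
      then show ?thesis
        using Cons.IH[of "u @ l"] Cons.prems by simp
    next
      case False
      then show ?thesis
        using Cons.prems by (intro exI[of _ "u # l # ls"]) auto
    qed
  qed
  then show ?case
    using Cons lyndon.letter[of x] by (metis append_Cons append_Nil)
qed

definition max_rotation :: "'x list \<Rightarrow> bool" where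
  "max_rotation w \<longleftrightarrow> (\<forall>i. val (rotate i w) \<le> val w)"

lemma ex_max_rotation:
  obtains i where "i \<le> length w" "max_rotation (rotate i w)"
proof -
  let ?V = "(\<lambda>i. val (rotate i w)) ` {..length w}"
  have "Max ?V \<in> ?V"
    by (intro Max_in) auto
  then obtain i where i: "i \<le> length w" "val (rotate i w) = Max ?V"
    unfolding image_iff by (metis atMost_iff)
  have "val (rotate j (rotate i w)) \<le> val (rotate i w)" for j
  proof (cases "w = []")
    case False
    then have "(j + i) mod length w \<in> {..length w}"
      by (simp add: less_imp_le)
    then have "val (rotate ((j + i) mod length w) w) \<le> Max ?V"
      by (intro Max_ge) auto
    then show ?thesis
      using i(2) by (simp add: rotate_rotate flip: rotate_conv_mod)
  qed simp
  then show ?thesis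
    using that i(1) by (auto simp: max_rotation_def)
qed

text \<open>
  Rotating the first factor of the Lyndon factorization to the end cannot increase a maximal rotation,
  so the remaining factors have on average no larger slope than the first one.  As the slopes are
  nondecreasing, they all agree, and so do the factors.
\<close>

lemma max_rotation_lyndon_power:
  assumes "max_rotation w" "w \<noteq> []"
  obtains z m where "lyndon z" "w = concat (replicate (Suc m) z)"
proof -
  obtain ls where ls: "concat ls = w" "\<forall>l\<in>set ls. lyndon l" "sorted (map slope ls)"
    using lyndon_factorization by blast
  then obtain z ms where zms: "ls = z # ms"
    using assms(2) by (cases ls) auto
  have ge: "\<forall>l\<in>set ms. l \<noteq> [] \<and> slope z \<le> slope l"
    using ls zms lyndon_nonempty by auto
  have "slope (concat ms) \<le> slope z" if "ms \<noteq> []"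
  proof -
    have ne: "concat ms \<noteq> []" "z \<noteq> []"
      using that ge ls(2) zms lyndon_nonempty by (auto simp: neq_Nil_conv)
    have "val (concat ms @ z) \<le> val (z @ concat ms)"
      using assms(1) ls(1) zms unfolding max_rotation_def by (metis concat.simps(2) rotate_append)
    then show ?thesis
      using val_swap_less_iff[OF ne] by simp
  qed
  then have "l = z" if "l \<in> set ms" for l
    using slope_eq_if_slope_concat_le[of ms "slope z" l] that ge ls(2) zms
    by (metis empty_iff empty_set list.set_intros lyndon_eq_if_slope_eq)
  then have "ms = replicate (length ms) z"
    by (simp add: replicate_eqI)
  then have "w = concat (replicate (Suc (length ms)) z)"
    using ls(1) zms by simp
  then show ?thesis
    using that[of z "length ms"] ls(2) zms by simp
qed

lemma slope_power: "z \<noteq> [] \<Longrightarrow> slope (concat (replicate (Suc m) z)) = slope z"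
proof (induction m)
  case (Suc m)
  have "slope (z @ concat (replicate (Suc m) z)) = slope z"
    using Suc by (intro slope_append_eq) auto
  then show ?case by simp
qed simp

lemma lyndon_power_append:
  assumes "lyndon z" "lyndon y" "slope y < slope z"
  shows "lyndon (concat (replicate m z) @ y) \<and> slope (concat (replicate m z) @ y) < slope z"
proof (induction m)
  case (Suc m)
  let ?y = "concat (replicate m z) @ y"
  have "lyndon (z @ ?y)" "slope (z @ ?y) < slope z"
    using Suc assms(1) lyndon_nonempty[of z] lyndon_nonempty[of ?y] slope_append_less_left[of z ?y]
    by (auto intro: lyndon.append)
  then show ?case by simp
qed (use assms in simp)

lemma lyndon_append_power:
  assumes "lyndon z" "lyndon y" "slope z < slope y"
  shows "lyndon (y @ concat (replicate m z))"
  using assms(2,3)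
proof (induction m arbitrary: y)
  case (Suc m)
  have "lyndon (y @ z)" "slope z < slope (y @ z)"
    using Suc.prems assms(1) lyndon_nonempty slope_append_less_right by (auto intro: lyndon.append)
  then show ?case
    using Suc.IH by fastforce
qed simp

lemma lyndon_max_rotation_append:
  assumes "max_rotation w" "w \<noteq> []" "lyndon y" "slope y < slope w"
  shows "lyndon (w @ y)"
  using max_rotation_lyndon_power[OF assms(1,2)] lyndon_power_append[OF _ assms(3)] slope_power assms(4)
    lyndon_nonempty by metis

lemma lyndon_append_max_rotation:
  assumes "max_rotation w" "w \<noteq> []" "lyndon y" "slope w < slope y"
  shows "lyndon (y @ w)"
  using max_rotation_lyndon_power[OF assms(1,2)] lyndon_append_power[OF _ assms(3)] slope_power assms(4)
    lyndon_nonempty by metis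

lemma lyndon_max_rotations_append:
  assumes u: "max_rotation u" "u \<noteq> []" and v: "max_rotation v" "v \<noteq> []" and less: "slope v < slope u"
  shows "lyndon (u @ v)"
proof -
  obtain z m where z: "lyndon z" "v = concat (replicate (Suc m) z)"
    using max_rotation_lyndon_power[OF v] .
  have "slope v = slope z"
    using slope_power z lyndon_nonempty by simp
  then have "lyndon (u @ z)" "slope z < slope (u @ z)"
    using lyndon_max_rotation_append[OF u z(1)] slope_append_less_right u(2) z(1) lyndon_nonempty less by auto
  then show ?thesis
    using lyndon_append_power[OF z(1), of "u @ z" m] z(2) by simp
qed

text \<open>
  Two maximal rotations of different slope need not be Lyndon words themselves, only powers of such.
  In products, the powers can be attached one Lyndon factor at a time, since averaging keeps the slopes
  in the required order.
\<close>

lemma lyndon_pair: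
  assumes u: "max_rotation u" "u \<noteq> []" and v: "max_rotation v" "v \<noteq> []" and less: "slope v < slope u"
  shows "lyndon (u @ u @ v)" "lyndon (u @ v @ v)"
proof -
  have uv: "lyndon (u @ v)"
    using lyndon_max_rotations_append[OF assms] .
  have uv_less: "slope v < slope (u @ v)" "slope (u @ v) < slope u"
    using slope_append_less_left slope_append_less_right u(2) v(2) less by blast+
  show "lyndon (u @ u @ v)"
    using lyndon_max_rotation_append[OF u uv uv_less(2)] .
  show "lyndon (u @ v @ v)"
    using lyndon_append_max_rotation[OF v uv uv_less(1)] by simp
qed

end

section \<open>Hall trees\<close>

datatype 'x tree = Leaf 'x | Node "'x tree" "'x tree"

primrec foliage :: "'x tree \<Rightarrow> 'x list" where
  "foliage (Leaf x) = [x]"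
| "foliage (Node a b) = foliage a @ foliage b"

primrec tree_eval :: "('l \<Rightarrow> 'l \<Rightarrow> 'l) \<Rightarrow> ('x \<Rightarrow> 'l) \<Rightarrow> 'x tree \<Rightarrow> 'l" where
  "tree_eval br g (Leaf x) = g x"
| "tree_eval br g (Node a b) = br (tree_eval br g a) (tree_eval br g b)"

lemma foliage_nonempty [simp]: "foliage t \<noteq> []"
  by (induction t) auto

context digits
begin

abbreviation tslope :: "'x tree \<Rightarrow> real" where
  "tslope t \<equiv> slope (foliage t)"

text \<open>
  The trees of the standard bracketings of Lyndon words.  In terms of general Hall sets, the order is
  that of the slopes, and the condition on \<open>a2\<close> singles out one bracketing for each Lyndon word.
\<close>

fun hall :: "'x tree \<Rightarrow> bool" where
  "hall (Leaf x) = True"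
| "hall (Node (Leaf x) b) = (hall b \<and> tslope b < tslope (Leaf x))"
| "hall (Node (Node a1 a2) b) =
    (hall (Node a1 a2) \<and> hall b \<and> tslope b < tslope (Node a1 a2) \<and> tslope a2 \<le> tslope b)"

lemma hall_NodeD: "hall (Node a b) \<Longrightarrow> hall a \<and> hall b \<and> tslope b < tslope a"
  by (cases a) simp_all

lemma lyndon_foliage: "hall t \<Longrightarrow> lyndon (foliage t)"
  by (induction t) (auto dest: hall_NodeD intro: lyndon.intros)

text \<open>
  Among all proper suffixes, the right subtree has maximal slope.  The Hall condition
  \<open>tslope a2 \<le> tslope b\<close> carries this from the left subtree to the whole tree: a suffix that reaches into
  the left subtree is \<open>e' @ foliage b\<close>, and both parts have slope at most that of \<open>b\<close>.
\<close>

lemma hall_suffix_slope_le: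
  assumes "hall (Node a b)" "foliage (Node a b) = p @ e" "p \<noteq> []" "e \<noteq> []"
  shows "slope e \<le> tslope b"
  using assms
proof (induction a arbitrary: b p e)
  case (Leaf x)
  then obtain p' where "foliage b = p' @ e"
    by (auto simp: Cons_eq_append_conv)
  then show ?case
    using lyndon_suffix_slope[of p' e] lyndon_foliage[of b] hall_NodeD[OF Leaf.prems(1)] Leaf.prems(4)
    by (cases "p' = []") auto
next
  case (Node a1 a2)
  have b: "lyndon (foliage b)"
    using Node.prems(1) lyndon_foliage by auto
  from Node.prems(2) consider (long) e' where "foliage (Node a1 a2) = p @ e'" "e = e' @ foliage b"
    | (short) p' where "foliage b = p' @ e"
    unfolding foliage.simps(2)[of "Node a1 a2"] append_eq_append_conv2 by metis
  then show ?case
  proof cases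
    case long
    show ?thesis
    proof (cases "e' = []")
      case False
      have "slope e' \<le> tslope a2"
        using Node.IH(1)[of a2 p e'] long False Node.prems(1,3) by auto
      also have "\<dots> \<le> tslope b"
        using Node.prems(1) by simp
      finally show ?thesis
        using slope_append[OF False foliage_nonempty[of b]] long by (auto simp: not_less[symmetric])
    qed (use long in simp)
  next
    case short
    then show ?thesis
      using lyndon_suffix_slope[of p' e] b Node.prems(4) by (cases "p' = []") auto
  qed
qed

text \<open>
  If two Hall trees with the same word split it at different places, the shorter right part is a proper
  suffix of the longer one and so has smaller slope, whereas the right part has maximal slope
  among the proper suffixes.
\<close>

lemma hall_unique: "hall s \<Longrightarrow> hall t \<Longrightarrow> foliage s = foliage t \<Longrightarrow> s = t"
proof (induction s arbitrary: t)
  case (Leaf x)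
  then show ?case
    by (cases t) (auto simp: Cons_eq_append_conv)
next
  case (Node a b)
  then obtain a' b' where t: "t = Node a' b'"
    by (cases t) (auto simp: append_eq_Cons_conv)
  have not_suffix: False
    if "hall (Node a b)" "hall (Node a' b')" "foliage a @ foliage b = foliage a' @ foliage b'"
      "foliage b' = e @ foliage b" "e \<noteq> []" for a b a' b' :: "'x tree" and e
  proof -
    have "tslope b < tslope b'"
      using lyndon_suffix_slope[of e "foliage b"] lyndon_foliage[of b'] hall_NodeD[OF that(2)] that(4,5)
      by simp
    moreover have "tslope b' \<le> tslope b"
      using hall_suffix_slope_le[OF that(1), of "foliage a'" "foliage b'"] that(3) by simp
    ultimately show False by simp
  qed
  have eq: "foliage a @ foliage b = foliage a' @ foliage b'"
    using Node.prems(3) t by simp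
  from eq consider e where "foliage b' = e @ foliage b" | e where "foliage b = e @ foliage b'"
    unfolding append_eq_append_conv2 by metis
  then have "foliage b = foliage b'"
    using not_suffix[of a b a' b'] not_suffix[of a' b' a b] eq Node.prems t by (metis append_Nil)
  then show ?case
    using Node eq t hall_NodeD by (metis append_same_eq)
qed

lemma hall_eq_if_slope_eq: "hall s \<Longrightarrow> hall t \<Longrightarrow> tslope s = tslope t \<Longrightarrow> s = t"
  using hall_unique lyndon_eq_if_slope_eq lyndon_foliage by blast

end

section \<open>Hall trees span\<close>

context module
begin

lemma bilinear_span:
  assumes x: "x \<in> span X" and y: "y \<in> span Y" and S: "subspace S"
    and add_left: "\<And>x x' y. f (x + x') y = f x y + f x' y"
    and add_right: "\<And>x y y'. f x (y + y') = f x y + f x y'"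
    and scale_left: "\<And>r x y. f (scale r x) y = scale r (f x y)"
    and scale_right: "\<And>r x y. f x (scale r y) = scale r (f x y)"
    and gen: "\<And>x y. x \<in> X \<Longrightarrow> y \<in> Y \<Longrightarrow> f x y \<in> S"
  shows "f x y \<in> S"
proof -
  have zero: "f 0 y = 0" "f x 0 = 0" for x y
    using scale_left[of 0 0 y] scale_right[of x 0 0] by simp_all
  have gen_left: "f x y \<in> S" if "x \<in> X" for x
    using y by (induction rule: span_induct_alt)
      (use S that in \<open>auto simp: zero add_right scale_right gen intro!: subspace_0 subspace_add subspace_scale\<close>)
  show ?thesis
    using x by (induction rule: span_induct_alt)
      (use S gen_left in \<open>auto simp: zero add_left scale_left intro!: subspace_0 subspace_add subspace_scale\<close>)
qed

end

context lie_algebra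
begin

lemma br_antisym: "br x y = - br y x"
proof -
  have "br (x + y) (x + y) = 0"
    by (rule br_self)
  then have "br x y + br y x = 0"
    unfolding br_add_left br_add_right by (simp add: br_self add.commute)
  then show ?thesis
    by (simp add: eq_neg_iff_add_eq_0)
qed

lemma br_neg: "br (- x) y = - br x y" "br x (- y) = - br x y"
  using br_scale_left[of "-1" x y] br_scale_right[of x "-1" y] by simp_all

text \<open>
  This form of the Jacobi identity rewrites \<open>[[x, y], z]\<close> when the Hall condition fails.
\<close>

lemma br_derivation: "br (br x y) z = br (br x z) y + br x (br y z)"
  using jacobi[of x y z] br_antisym[of "br x y" z] br_antisym[of y "br z x"] br_antisym[of "br x z" y]
    br_antisym[of z x] br_neg
  by (metis (no_types, lifting) add.commute add.inverse_inverse add_eq_0_iff diff_eq_eq minus_diff_eq uminus_add_conv_diff)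

lemmas br_span = bilinear_span[where f = br, OF _ _ _ br_add_left br_add_right br_scale_left br_scale_right]

end

locale lie_hall = lie_algebra scale br + digits c B
  for scale :: "'r::comm_ring_1 \<Rightarrow> 'l::ab_group_add \<Rightarrow> 'l" and br
    and c :: "'x::finite \<Rightarrow> nat" and B +
  fixes g :: "'x \<Rightarrow> 'l"
begin

abbreviation ev :: "'x tree \<Rightarrow> 'l" where
  "ev \<equiv> tree_eval br g"

text \<open>
  The bound \<open>s\<close> on the slope of the right subtrees is the invariant that makes the rewriting of
  brackets into Hall trees terminate.
\<close>

definition hall_span :: "nat \<Rightarrow> real \<Rightarrow> 'l set" where
  "hall_span n s = span {ev (Node a b) | a b.
    hall (Node a b) \<and> length (foliage (Node a b)) = n \<and> s \<le> tslope b}"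

definition slopes_above :: "nat \<Rightarrow> real \<Rightarrow> real set" where
  "slopes_above n s = {r \<in> slope ` {w. length w \<le> n}. s < r}"

lemma slopes_above_less:
  assumes "s < s'" "s' = slope w" "length w \<le> n"
  shows "card (slopes_above n s') < card (slopes_above n s)"
proof (rule psubset_card_mono)
  have "finite {w :: 'x list. length w \<le> n}"
    using finite_lists_length_le[of "UNIV :: 'x set" n] by simp
  then show "finite (slopes_above n s)"
    by (simp add: slopes_above_def)
  have "s' \<in> slopes_above n s" "s' \<notin> slopes_above n s'"
    using assms by (auto simp: slopes_above_def)
  then show "slopes_above n s' \<subset> slopes_above n s"
    using assms(1) by (auto simp: slopes_above_def)
qed

lemma hall_span_mono: "s \<le> s' \<Longrightarrow> hall_span n s' \<subseteq> hall_span n s"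
  unfolding hall_span_def by (intro span_mono) force

lemma br_hall_span:
  assumes "x \<in> hall_span m s"
    and "\<And>a b. hall (Node a b) \<Longrightarrow> length (foliage (Node a b)) = m \<Longrightarrow> s \<le> tslope b \<Longrightarrow>
      br (ev (Node a b)) y \<in> hall_span n s'"
  shows "br x y \<in> hall_span n s'"
  unfolding hall_span_def[of n]
  by (rule br_span[OF assms(1)[unfolded hall_span_def] span_base[of y "{y}"] subspace_span])
    (use assms(2) in \<open>auto simp del: tree_eval.simps simp: hall_span_def\<close>)

text \<open>
  Let \<open>tslope k < tslope h\<close>.  If \<open>Node h k\<close> is not a Hall tree, then \<open>h = Node h1 h2\<close> with \<open>k\<close> of smaller
  slope than \<open>h2\<close>, and \<open>[[h1, h2], k] = [[h1, k], h2] + [h1, [h2, k]]\<close>.  The inner brackets have smaller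
  length, hence are combinations of Hall trees whose right subtrees, and therefore the trees
  themselves, have slope at least that of \<open>k\<close>; for the trees themselves the inequality is strict.
  In the outer brackets both entries thus have slope larger than that of \<open>k\<close>.  Since there are only
  finitely many slopes of words of bounded length, induction on the length and then on the smaller
  slope applies.
\<close>

lemma br_hall:
  assumes "hall h" "hall k"
  shows "br (ev h) (ev k) \<in> hall_span (length (foliage h) + length (foliage k)) (min (tslope h) (tslope k))"
  using assms
proof (induction "(h, k)" arbitrary: h k rule: wf_induct_rule[OF wf_measures[of
    "[\<lambda>(h, k). length (foliage h) + length (foliage k),
      \<lambda>(h, k). card (slopes_above (length (foliage h) + length (foliage k)) (min (tslope h) (tslope k)))]"]])
  case (1 h k)
  note IH = 1(1)
  define n where "n = length (foliage h) + length (foliage k)"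
  have IH_deg: "br (ev h') (ev k') \<in> hall_span m s"
    if "hall h'" "hall k'" "length (foliage h') + length (foliage k') = m" "m < n"
      "s \<le> min (tslope h') (tslope k')" for h' k' m s
    using IH[of h' k'] that hall_span_mono[of s "min (tslope h') (tslope k')" m] by (auto simp: n_def)
  have IH_slope: "br (ev h') (ev k') \<in> hall_span n (min (tslope h) (tslope k))"
    if "hall h'" "hall k'" "length (foliage h') + length (foliage k') = n"
      "min (tslope h) (tslope k) < min (tslope h') (tslope k')" for h' k'
  proof -
    have "card (slopes_above n (min (tslope h') (tslope k'))) < card (slopes_above n (min (tslope h) (tslope k)))"
      using that by (intro slopes_above_less[of _ _ "if tslope h' \<le> tslope k' then foliage h' else foliage k'"]) auto
    then have "br (ev h') (ev k') \<in> hall_span n (min (tslope h') (tslope k'))"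
      using IH[of h' k'] that unfolding n_def by simp
    then show ?thesis
      using hall_span_mono[OF less_imp_le[OF that(4)]] by blast
  qed
  have main: "br (ev x) (ev y) \<in> hall_span n (tslope y)"
    if xy: "hall x" "hall y" "tslope y < tslope x" and hk: "{x, y} = {h, k}" for x y
  proof (cases "hall (Node x y)")
    case True
    moreover have "length (foliage (Node x y)) = n"
      using hk by (auto simp: n_def doubleton_eq_iff)
    ultimately have "ev (Node x y) \<in> hall_span n (tslope y)"
      unfolding hall_span_def by (intro span_base CollectI exI[of _ x] exI[of _ y] conjI HOL.refl order_refl)
    then show ?thesis by simp
  next
    case False
    then obtain x1 x2 where x: "x = Node x1 x2"
      using xy by (cases x) auto
    have n: "n = length (foliage x1) + length (foliage x2) + length (foliage y)"
      and min: "min (tslope h) (tslope k) = tslope y"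
      using hk xy(3) by (auto simp: x n_def doubleton_eq_iff)
    have y_x2: "tslope y < tslope x2"
      using False xy x by auto
    have x12: "hall x1" "hall x2" "tslope x2 < tslope x1"
      using hall_NodeD[of x1 x2] xy(1) unfolding x by blast+
    have above: "tslope y < tslope (Node a b)" if "hall (Node a b)" "tslope y \<le> tslope b" for a b
      using hall_NodeD[OF that(1)] slope_append_less_right[of "foliage a" "foliage b"] that(2) by simp
    have "br (ev x1) (ev y) \<in> hall_span (length (foliage x1) + length (foliage y)) (tslope y)"
      using xy x12 y_x2 by (intro IH_deg) (auto simp: n)
    then have 1: "br (br (ev x1) (ev y)) (ev x2) \<in> hall_span n (tslope y)"
    proof (rule br_hall_span)
      fix a b
      assume ab: "hall (Node a b)" "length (foliage (Node a b)) = length (foliage x1) + length (foliage y)"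
        "tslope y \<le> tslope b"
      show "br (ev (Node a b)) (ev x2) \<in> hall_span n (tslope y)"
        unfolding min[symmetric] using ab(1) x12(2)
        by (rule IH_slope) (use ab above[OF ab(1,3)] y_x2 min n in simp_all)
    qed
    have "br (ev x2) (ev y) \<in> hall_span (length (foliage x2) + length (foliage y)) (tslope y)"
      using xy x12 y_x2 by (intro IH_deg) (auto simp: n)
    then have "br (br (ev x2) (ev y)) (ev x1) \<in> hall_span n (tslope y)"
    proof (rule br_hall_span)
      fix a b
      assume ab: "hall (Node a b)" "length (foliage (Node a b)) = length (foliage x2) + length (foliage y)"
        "tslope y \<le> tslope b"
      show "br (ev (Node a b)) (ev x1) \<in> hall_span n (tslope y)"
        unfolding min[symmetric] using ab(1) x12(1)
        by (rule IH_slope) (use ab above[OF ab(1,3)] y_x2 x12(3) min n in simp_all)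
    qed
    then have 2: "br (ev x1) (br (ev x2) (ev y)) \<in> hall_span n (tslope y)"
      unfolding hall_span_def br_antisym[of "ev x1"] by (rule span_neg)
    show ?thesis
      using span_add[OF 1[unfolded hall_span_def] 2[unfolded hall_span_def]]
      unfolding hall_span_def x by (simp add: br_derivation[of "ev x1" "ev x2" "ev y"])
  qed
  consider "tslope h = tslope k" | "tslope k < tslope h" | "tslope h < tslope k"
    by linarith
  then show ?case
  proof cases
    case 1
    then have "h = k"
      using hall_eq_if_slope_eq \<open>hall h\<close> \<open>hall k\<close> by blast
    then show ?thesis
      by (simp add: br_self hall_span_def span_zero)
  next
    case 2
    then show ?thesis
      using main[of h k] \<open>hall h\<close> \<open>hall k\<close> by (simp add: n_def)
  next
    case 3
    then have "br (ev k) (ev h) \<in> hall_span n (tslope h)"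
      using main[of k h] \<open>hall h\<close> \<open>hall k\<close> by (simp add: insert_commute)
    then show ?thesis
      using 3 br_antisym[of "ev h" "ev k"] unfolding hall_span_def n_def by (simp add: span_neg)
  qed
qed

lemma lie_eval_in_hall_span: "lie_eval scale br g s \<in> span (ev ` {t. hall t})"
proof (induction s)
  case (LVar x)
  have "ev (Leaf x) \<in> span (ev ` {t. hall t})"
    by (intro span_base imageI) simp
  then show ?case by simp
next
  case (LBr s t)
  show ?case
    unfolding lie_eval.simps
  proof (rule br_span[OF LBr subspace_span])
    fix x y
    assume "x \<in> ev ` {t. hall t}" "y \<in> ev ` {t. hall t}"
    then obtain h k where hk: "hall h" "hall k" "x = ev h" "y = ev k"
      by blast
    have "hall_span m r \<subseteq> span (ev ` {t. hall t})" for m r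
      unfolding hall_span_def by (intro span_mono) blast
    then show "br x y \<in> span (ev ` {t. hall t})"
      using br_hall[OF hk(1,2)] hk by blast
  qed
qed (simp_all add: span_zero span_add span_scale)

end

section \<open>The free Lie algebra\<close>

lemma equivp_lie_eq: "equivp lie_eq"
  by (intro equivpI reflpI sympI transpI) (fact lie_eq.refl lie_eq.sym lie_eq.trans)+

text \<open>
  A concrete model of the free Lie algebra.  The spanning result, applied to this model, becomes a
  statement about the congruence \<open>lie_eq\<close>.
\<close>

quotient_type (overloaded) ('r, 'x) free_lie = "('r::comm_ring_1, 'x) lie_term" / lie_eq
  by (rule equivp_lie_eq)

instantiation free_lie :: (comm_ring_1, type) ab_group_add
begin

lift_definition zero_free_lie :: "('a, 'b) free_lie" is LZero .

lift_definition plus_free_lie :: "('a, 'b) free_lie \<Rightarrow> ('a, 'b) free_lie \<Rightarrow> ('a, 'b) free_lie" is LAdd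
  by (rule lie_eq.cong_add)

lift_definition uminus_free_lie :: "('a, 'b) free_lie \<Rightarrow> ('a, 'b) free_lie" is "LScale (- 1)"
  by (rule lie_eq.cong_scale)

definition minus_free_lie :: "('a, 'b) free_lie \<Rightarrow> ('a, 'b) free_lie \<Rightarrow> ('a, 'b) free_lie" where
  "minus_free_lie x y = x + - y"

instance
proof
  fix x y z :: "('a, 'b) free_lie"
  show "x + y + z = x + (y + z)" "x + y = y + x" "0 + x = x"
    by (transfer, rule lie_eq.add_assoc lie_eq.add_commute lie_eq.add_zero)+
  show "- x + x = 0"
    by transfer (rule lie_eq.trans[OF lie_eq.add_commute lie_eq.add_neg])
qed (simp add: minus_free_lie_def)

end

lift_definition fl_scale :: "'r::comm_ring_1 \<Rightarrow> ('r, 'x) free_lie \<Rightarrow> ('r, 'x) free_lie" is LScale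
  by (rule lie_eq.cong_scale)

lift_definition fl_br :: "('r::comm_ring_1, 'x) free_lie \<Rightarrow> ('r, 'x) free_lie \<Rightarrow> ('r, 'x) free_lie" is LBr
  by (rule lie_eq.cong_br)

lift_definition fl_var :: "'x \<Rightarrow> ('r::comm_ring_1, 'x) free_lie" is LVar .

lemma lie_algebra_free_lie: "lie_algebra fl_scale fl_br"
  by unfold_locales (transfer, rule lie_eq.scale_add_right lie_eq.scale_add_left lie_eq.scale_scale lie_eq.scale_one
      lie_eq.br_add_left lie_eq.br_add_right lie_eq.br_scale_left lie_eq.br_scale_right lie_eq.br_self
      lie_eq.jacobi)+

lemma lie_eval_free_lie: "lie_eval fl_scale fl_br fl_var s = abs_free_lie s"
  by (induction s)
    (simp_all add: fl_var.abs_eq zero_free_lie.abs_eq plus_free_lie.abs_eq fl_scale.abs_eq fl_br.abs_eq)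

context lie_hall
begin

text \<open>
  The difference of two Lie expressions is, in the free Lie algebra, a combination of Hall trees.  If
  the expressions have the same value, the values of these Hall trees satisfy the same linear
  relation, so independence forces all its coefficients to vanish.
\<close>

lemma lie_eq_if_hall_independent:
  assumes indep: "\<And>S r. finite S \<Longrightarrow> S \<subseteq> {t. hall t} \<Longrightarrow> (\<Sum>t\<in>S. scale (r t) (ev t)) = 0 \<Longrightarrow>
      \<forall>t\<in>S. r t = 0"
    and eq: "lie_eval scale br g s = lie_eval scale br g t"
  shows "lie_eq s t"
proof -
  interpret F: lie_algebra fl_scale "fl_br :: ('r, 'x) free_lie \<Rightarrow> _"
    by (rule lie_algebra_free_lie)
  interpret F: lie_hall fl_scale fl_br c B "fl_var :: 'x \<Rightarrow> ('r, 'x) free_lie"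
    by unfold_locales
  \<comment> \<open>The homomorphism from the free Lie algebra that sends the generators to \<open>g\<close>.\<close>
  define \<phi> where "\<phi> x = lie_eval scale br g (rep_free_lie x)" for x
  have phi: "\<phi> (abs_free_lie u) = lie_eval scale br g u" for u
    unfolding \<phi>_def
    by (rule lie_eval_eq) (rule Quotient3_rep_abs[OF Quotient3_free_lie lie_eq.refl])
  have abs: "\<exists>u. x = abs_free_lie u" for x :: "('r, 'x) free_lie"
    by (metis Quotient3_abs_rep[OF Quotient3_free_lie])
  have phi_add: "\<phi> (x + y) = \<phi> x + \<phi> y" for x y
    using abs[of x] abs[of y] by (auto simp: plus_free_lie.abs_eq phi)
  have phi_scale: "\<phi> (fl_scale r x) = scale r (\<phi> x)" for r x
    using abs[of x] by (auto simp: fl_scale.abs_eq phi)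
  have phi_br: "\<phi> (fl_br x y) = br (\<phi> x) (\<phi> y)" for x y
    using abs[of x] abs[of y] by (auto simp: fl_br.abs_eq phi)
  have phi_0: "\<phi> 0 = 0"
    by (simp add: zero_free_lie.abs_eq phi)
  have phi_ev: "\<phi> (F.ev h) = ev h" for h
    by (induction h) (simp_all add: phi_br fl_var.abs_eq phi)
  have phi_sum: "\<phi> (\<Sum>h\<in>S. f h) = (\<Sum>h\<in>S. \<phi> (f h))" for S :: "'x tree set" and f
    by (induction S rule: infinite_finite_induct) (simp_all add: phi_0 phi_add)
  define d where "d = abs_free_lie s - abs_free_lie t"
  have "d \<in> F.span (F.ev ` {h. hall h})"
    unfolding d_def lie_eval_free_lie[symmetric] by (intro F.span_diff F.lie_eval_in_hall_span)
  then obtain X r where X: "finite X" "X \<subseteq> F.ev ` {h. hall h}" "d = (\<Sum>x\<in>X. fl_scale (r x) x)"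
    unfolding F.span_explicit by (elim CollectE exE conjE) (rule that)
  from X(2) obtain S where S: "S \<subseteq> {h. hall h}" "inj_on F.ev S" "X = F.ev ` S"
    unfolding subset_image_inj by blast
  have d: "d = (\<Sum>h\<in>S. fl_scale (r (F.ev h)) (F.ev h))"
    using X(3) S by (simp add: sum.reindex)
  have "abs_free_lie s = d + abs_free_lie t"
    by (simp add: d_def)
  then have "\<phi> d = 0"
    using eq phi[of s] phi[of t] phi_add[of d "abs_free_lie t"] by simp
  then have "(\<Sum>h\<in>S. scale (r (F.ev h)) (ev h)) = 0"
    unfolding d phi_sum by (simp add: phi_scale phi_ev)
  then have "\<forall>h\<in>S. r (F.ev h) = 0"
    using indep[of S "\<lambda>h. r (F.ev h)"] S X(1) by (simp add: finite_image_iff)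
  then have "d = 0"
    unfolding d by simp
  then have "abs_free_lie s = abs_free_lie t"
    by (simp add: d_def)
  then show ?thesis
    by (simp add: free_lie.abs_eq_iff)
qed

end

section \<open>Leading words in monomial algebras\<close>

lemma word_val_append: "u \<noteq> [] \<Longrightarrow> v \<noteq> [] \<Longrightarrow> word_val a (u @ v) = word_val a u * word_val a v"
proof (induction a u rule: word_val.induct)
  case (2 a i)
  then show ?case by (cases v) auto
qed (auto simp: mult.assoc)

lemma word_val_factor_nonzero:
  assumes "word_val a (p @ v @ s) \<noteq> 0" "v \<noteq> []"
  shows "word_val a v \<noteq> 0"
  using assms word_val_append[of p "v @ s" a] word_val_append[of v s a]
  by (cases "p = []"; cases "s = []") auto

context
  fixes scale :: "'r::comm_ring_1 \<Rightarrow> 'a::ring \<Rightarrow> 'a" and A and a :: "'n::finite \<Rightarrow> 'a"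
  assumes monomial: "monomial_algebra scale A a"
begin

interpretation assoc_algebra scale
  using monomial by (simp add: monomial_algebra_def)

lemma free_alg_eval_eq_sum:
  assumes "finite K" "Poly_Mapping.keys p \<subseteq> K"
  shows "free_alg_eval scale a p = (\<Sum>w\<in>K. scale (Poly_Mapping.lookup p w) (word_val a w))"
  unfolding free_alg_eval_def using assms
  by (intro sum.mono_neutral_left) (auto simp: in_keys_iff)

lemma free_alg_eval_add:
  "free_alg_eval scale a (p + q) = free_alg_eval scale a p + free_alg_eval scale a q"
proof -
  let ?K = "Poly_Mapping.keys p \<union> Poly_Mapping.keys q"
  have "Poly_Mapping.keys (p + q) \<subseteq> ?K"
    by (rule Poly_Mapping.keys_add)
  then show ?thesis
    by (simp add: free_alg_eval_eq_sum[of ?K] lookup_add scale_left_distrib sum.distrib)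
qed

lemma free_alg_eval_single: "free_alg_eval scale a (Poly_Mapping.single w r) = scale r (word_val a w)"
  by (simp add: free_alg_eval_eq_sum[of "{w}"])

text \<open>
  The polynomials all of whose words have a factor in \<open>C\<close> form an ideal containing \<open>C\<close>, and hence
  containing all relations; conversely such words lie in the ideal generated by \<open>C\<close>, so they vanish.
\<close>

lemma zero_word_if_relation:
  assumes "Poly_Mapping.lookup p [] = 0" "free_alg_eval scale a p = 0" "w \<in> Poly_Mapping.keys p"
  shows "word_val a w = 0"
proof -
  obtain C where ker: "{p. Poly_Mapping.lookup p [] = 0 \<and> free_alg_eval scale a p = 0} =
      two_sided_ideal hull ((\<lambda>c. Poly_Mapping.single c 1) ` C)"
    using monomial unfolding monomial_algebra_def by blast
  let ?X = "(\<lambda>c. Poly_Mapping.single c (1::'r)) ` C"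
  let ?J = "{p :: 'n list \<Rightarrow>\<^sub>0 'r. \<forall>w\<in>Poly_Mapping.keys p. \<exists>u c v. c \<in> C \<and> w = u @ c @ v}"
  have "two_sided_ideal ?J"
    unfolding two_sided_ideal_def
  proof (intro conjI ballI allI)
    fix p q :: "'n list \<Rightarrow>\<^sub>0 'r"
    assume "p \<in> ?J"
    show "p + q \<in> ?J" if "q \<in> ?J"
      using \<open>p \<in> ?J\<close> that Poly_Mapping.keys_add[of p q] by blast
    show "q * p \<in> ?J"
    proof safe
      fix w assume "w \<in> Poly_Mapping.keys (q * p)"
      then obtain x y where "w = x + y" "y \<in> Poly_Mapping.keys p"
        using keys_mult[of q p] by blast
      moreover from this obtain u c v where "c \<in> C" "y = u @ c @ v"
        using \<open>p \<in> ?J\<close> by blast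
      ultimately show "\<exists>u c v. c \<in> C \<and> w = u @ c @ v"
        by (intro exI[of _ "x @ u"] exI[of _ c] exI[of _ v]) (simp add: plus_list_def)
    qed
    show "p * q \<in> ?J"
    proof safe
      fix w assume "w \<in> Poly_Mapping.keys (p * q)"
      then obtain x y where "w = x + y" "x \<in> Poly_Mapping.keys p"
        using keys_mult[of p q] by blast
      moreover from this obtain u c v where "c \<in> C" "x = u @ c @ v"
        using \<open>p \<in> ?J\<close> by blast
      ultimately show "\<exists>u c v. c \<in> C \<and> w = u @ c @ v"
        by (intro exI[of _ u] exI[of _ c] exI[of _ "v @ y"]) (simp add: plus_list_def)
    qed
  qed simp
  moreover have "?X \<subseteq> ?J"
    by auto (metis append_Nil append_Nil2)
  ultimately have "two_sided_ideal hull ?X \<subseteq> ?J"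
    by (rule hull_minimal[rotated])
  then obtain u c v where c: "c \<in> C" "w = u @ c @ v"
    using assms ker by blast
  have ideal: "r * x \<in> two_sided_ideal hull ?X" "x * r \<in> two_sided_ideal hull ?X"
    if "x \<in> two_sided_ideal hull ?X" for r x
    using that unfolding hull_def two_sided_ideal_def by blast+
  have "Poly_Mapping.single c 1 \<in> two_sided_ideal hull ?X"
    using c(1) by (blast intro: hull_inc)
  then have "Poly_Mapping.single u 1 * (Poly_Mapping.single c 1 * Poly_Mapping.single v 1)
      \<in> two_sided_ideal hull ?X"
    using ideal by blast
  then have "Poly_Mapping.single w (1::'r) \<in> two_sided_ideal hull ?X"
    using c(2) by (simp add: mult_single plus_list_def)
  then have "free_alg_eval scale a (Poly_Mapping.single w (1::'r)) = 0"
    using ker by blast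
  then show ?thesis
    by (simp add: free_alg_eval_single)
qed

text \<open>
  Subtracting one side from the other gives a relation in which the word \<open>w\<close> has coefficient \<open>- r\<close>, and
  only vanishing words can occur in a relation.
\<close>

lemma nonzero_word_independent:
  assumes "w \<in> nonzero_words a" "scale r (word_val a w) \<in> span (word_val a ` (- {[], w}))"
  shows "r = 0"
proof -
  let ?P = "\<lambda>x. \<exists>q. Poly_Mapping.lookup q [] = 0 \<and> Poly_Mapping.lookup q w = 0 \<and> free_alg_eval scale a q = x"
  have "?P (scale r (word_val a w))"
    using assms(2)
  proof (induction rule: span_induct_alt)
    case base
    show ?case
      by (intro exI[of _ 0]) (simp add: free_alg_eval_def)
  next
    case (step s x y)
    then obtain v q where "v \<noteq> []" "v \<noteq> w" "x = word_val a v" "Poly_Mapping.lookup q [] = 0"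
      "Poly_Mapping.lookup q w = 0" "free_alg_eval scale a q = y"
      by auto
    then show ?case
      by (intro exI[of _ "Poly_Mapping.single v s + q"])
        (auto simp: free_alg_eval_add free_alg_eval_single lookup_add lookup_single)
  qed
  then obtain q where q: "Poly_Mapping.lookup q [] = 0" "Poly_Mapping.lookup q w = 0"
    "free_alg_eval scale a q = scale r (word_val a w)"
    by blast
  define p where "p = q + Poly_Mapping.single w (- r)"
  have w: "w \<noteq> []" "word_val a w \<noteq> 0"
    using assms(1) by (auto simp: nonzero_words_def)
  have "Poly_Mapping.lookup p [] = 0" "free_alg_eval scale a p = 0"
    using q w by (simp_all add: p_def free_alg_eval_add free_alg_eval_single lookup_add lookup_single)
  then have "w \<notin> Poly_Mapping.keys p"
    using zero_word_if_relation w(2) by blast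
  then show ?thesis
    using q(2) by (simp add: p_def in_keys_iff lookup_add)
qed

end

locale ordered_words = assoc_algebra scale + digits c B
  for scale :: "'r::comm_ring_1 \<Rightarrow> 'a::ring \<Rightarrow> 'a" and c :: "'n \<Rightarrow> nat" and B +
  fixes a :: "'n \<Rightarrow> 'a"
begin

definition lower_words :: "'n list \<Rightarrow> 'n list set" where
  "lower_words w = {v. length v = length w \<and> val v < val w}"

text \<open>
  The word \<open>w\<close> itself is allowed to vanish in the algebra, in which case being led by \<open>w\<close> only bounds the
  words that occur in \<open>x\<close>.  This keeps the products of leading words free of case distinctions.
\<close>

definition leads :: "'a \<Rightarrow> 'n list \<Rightarrow> bool" where
  "leads x w \<longleftrightarrow> w \<noteq> [] \<and> x - word_val a w \<in> span (word_val a ` lower_words w)"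

lemma leads_mult:
  assumes "leads x u" "leads y v"
  shows "leads (x * y) (u @ v)"
proof -
  define S where "S = span (word_val a ` lower_words (u @ v))"
  have ne: "u \<noteq> []" "v \<noteq> []"
    using assms by (auto simp: leads_def)
  have prod: "word_val a u' * word_val a v' \<in> S"
    if len: "length u' = length u" "length v' = length v" and le: "val u' \<le> val u" "val v' \<le> val v"
      and less: "val u' < val u \<or> val v' < val v" for u' v'
  proof -
    have "val (u' @ v') < val (u @ v)"
    proof (cases "val u' < val u")
      case True
      have "val u' * B ^ length v + val v' < (val u' + 1) * B ^ length v"
        using val_less[of v'] len by simp
      also have "\<dots> \<le> val u * B ^ length v"
        using True by (intro mult_right_mono) auto
      finally show ?thesis
        using len by (simp add: val_append)
    next
      case False
      then show ?thesis
        using le less len by (simp add: val_append)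
    qed
    moreover have "u' \<noteq> []" "v' \<noteq> []"
      using ne len by auto
    ultimately show ?thesis
      using len unfolding S_def by (intro span_base) (auto simp: lower_words_def word_val_append[symmetric])
  qed
  define x' y' where "x' = x - word_val a u" and "y' = y - word_val a v"
  have x': "x' \<in> span (word_val a ` lower_words u)" and y': "y' \<in> span (word_val a ` lower_words v)"
    using assms by (simp_all add: leads_def x'_def y'_def)
  note mult_span = bilinear_span[where f = "(*)", where S = S, OF _ _ _ distrib_right distrib_left
      scale_mult_left scale_mult_right]
  have S: "subspace S"
    unfolding S_def by (rule subspace_span)
  have "x' * y' \<in> S"
    by (rule mult_span[OF x' y' S]) (auto simp: lower_words_def intro!: prod)
  moreover have "x' * word_val a v \<in> S"
    by (rule mult_span[OF x' span_base[of _ "{word_val a v}"] S]) (auto simp: lower_words_def intro!: prod)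
  moreover have "word_val a u * y' \<in> S"
    by (rule mult_span[OF span_base[of _ "{word_val a u}"] y' S]) (auto simp: lower_words_def intro!: prod)
  ultimately have "x' * y' + x' * word_val a v + word_val a u * y' \<in> S"
    unfolding S_def by (intro span_add)
  moreover have "x' * y' + x' * word_val a v + word_val a u * y' = x * y - word_val a (u @ v)"
    using ne by (simp add: x'_def y'_def word_val_append algebra_simps)
  ultimately show ?thesis
    using ne by (simp add: leads_def S_def)
qed

lemma leads_in_span: "leads x w \<Longrightarrow> x \<in> span (word_val a ` {v. length v = length w \<and> val v \<le> val w})"
proof -
  assume "leads x w"
  then have "x - word_val a w \<in> span (word_val a ` lower_words w)"
    by (simp add: leads_def)
  also have "\<dots> \<subseteq> span (word_val a ` {v. length v = length w \<and> val v \<le> val w})"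
    by (intro span_mono) (auto simp: lower_words_def)
  finally have "x - word_val a w + word_val a w \<in> span (word_val a ` {v. length v = length w \<and> val v \<le> val w})"
    by (rule span_add) (auto intro: span_base)
  then show ?thesis by simp
qed

lemma leads_commutator:
  assumes "leads x u" "leads y v" "slope v < slope u"
  shows "leads (commutator x y) (u @ v)"
proof -
  have ne: "u \<noteq> []" "v \<noteq> []"
    using assms by (auto simp: leads_def)
  then have less: "val (v @ u) < val (u @ v)"
    using val_swap_less_iff assms(3) by blast
  have "y * x \<in> span (word_val a ` {w. length w = length (v @ u) \<and> val w \<le> val (v @ u)})"
    by (intro leads_in_span leads_mult assms)
  also have "\<dots> \<subseteq> span (word_val a ` lower_words (u @ v))"
    using less by (intro span_mono) (auto simp: lower_words_def)
  finally have "(x * y - word_val a (u @ v)) - y * x \<in> span (word_val a ` lower_words (u @ v))"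
    using leads_mult[OF assms(1,2)] span_diff unfolding leads_def by blast
  then show ?thesis
    using ne by (simp add: leads_def commutator_def algebra_simps)
qed

lemma leads_letter: "leads (a i) [i]"
  by (simp add: leads_def span_zero)

lemma lyndon_leads_lie_element:
  assumes "lyndon w"
  shows "\<exists>x \<in> is_lie_subalgebra scale commutator hull (range a). leads x w"
  using assms
proof induction
  case (letter i)
  then show ?case
    using leads_letter by (blast intro: hull_inc)
next
  case (append u v)
  then obtain x y where xy: "x \<in> is_lie_subalgebra scale commutator hull (range a)" "leads x u"
    "y \<in> is_lie_subalgebra scale commutator hull (range a)" "leads y v"
    by blast
  have "commutator x y \<in> is_lie_subalgebra scale commutator hull (range a)"
    using xy(1,3) unfolding hull_def is_lie_subalgebra_def by blast
  then show ?case
    using leads_commutator[OF xy(2,4) append.hyps(3)] by blast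
qed

text \<open>
  In a linear relation, the largest among the leading words of a fixed length whose coefficients do
  not vanish occurs in one summand only.
\<close>

lemma leading_words_independent:
  fixes x :: "'t \<Rightarrow> 'a" and w :: "'t \<Rightarrow> 'n list"
  assumes indep: "\<And>v r. v \<in> nonzero_words a \<Longrightarrow> scale r (word_val a v) \<in> span (word_val a ` (- {[], v})) \<Longrightarrow> r = 0"
    and S: "finite S" "inj_on w S" "\<And>t. t \<in> S \<Longrightarrow> leads (x t) (w t)" "\<And>t. t \<in> S \<Longrightarrow> w t \<in> nonzero_words a"
    and sum: "(\<Sum>t\<in>S. scale (r t) (x t)) = 0"
  shows "\<forall>t\<in>S. r t = 0"
proof (rule ccontr)
  assume "\<not> ?thesis"
  then obtain t\<^sub>0 where t\<^sub>0: "t\<^sub>0 \<in> S" "r t\<^sub>0 \<noteq> 0"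
    by blast
  define T where "T = {t\<in>S. r t \<noteq> 0 \<and> length (w t) = length (w t\<^sub>0)}"
  have "finite T" "T \<noteq> {}"
    using S(1) t\<^sub>0 by (auto simp: T_def)
  then have "Max ((\<lambda>s. val (w s)) ` T) \<in> (\<lambda>s. val (w s)) ` T"
    by (intro Max_in) auto
  then obtain t where t: "t \<in> T" and "val (w t) = Max ((\<lambda>s. val (w s)) ` T)"
    by auto
  then have max: "val (w s) \<le> val (w t)" if "s \<in> T" for s
    using that \<open>finite T\<close> by simp
  let ?V = "span (word_val a ` (- {[], w t}))"
  have tS: "t \<in> S" "r t \<noteq> 0" "length (w t) = length (w t\<^sub>0)"
    using t by (auto simp: T_def)
  have wt: "w t \<noteq> []"
    using S(3)[OF tS(1)] by (simp add: leads_def)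
  have other: "scale (r s) (x s) \<in> ?V" if s: "s \<in> S" "s \<noteq> t" for s
  proof (cases "r s = 0")
    case False
    have "w s \<noteq> w t"
      using S(2) s tS(1) by (auto dest: inj_onD)
    have "{v. length v = length (w s) \<and> val v \<le> val (w s)} \<subseteq> - {[], w t}"
    proof (cases "length (w s) = length (w t)")
      case True
      then have "val (w s) < val (w t)"
        using max[of s] s False tS val_inj \<open>w s \<noteq> w t\<close> by (fastforce simp: T_def order_less_le)
      then show ?thesis
        using True wt by auto
    next
      case False
      then show ?thesis
        using S(3)[OF s(1)] by (auto simp: leads_def)
    qed
    then have "x s \<in> ?V"
      using leads_in_span[OF S(3)[OF s(1)]] span_mono[OF image_mono] by blast
    then show ?thesis
      by (rule span_scale)
  qed (simp add: span_zero)
  have "lower_words (w t) \<subseteq> - {[], w t}"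
    using wt by (auto simp: lower_words_def)
  then have "x t - word_val a (w t) \<in> ?V"
    using S(3)[OF tS(1)] span_mono[OF image_mono] unfolding leads_def by blast
  then have "scale (r t) (x t - word_val a (w t)) \<in> ?V"
    by (rule span_scale)
  moreover have "(\<Sum>s\<in>S - {t}. scale (r s) (x s)) \<in> ?V"
    using other by (intro span_sum) auto
  moreover have "scale (r t) (x t) = - (\<Sum>s\<in>S - {t}. scale (r s) (x s))"
    using sum S(1) tS(1) by (simp add: sum.remove eq_neg_iff_add_eq_0)
  ultimately have "- (\<Sum>s\<in>S - {t}. scale (r s) (x s)) - scale (r t) (x t - word_val a (w t)) \<in> ?V"
    by (intro span_diff span_neg)
  then have "scale (r t) (word_val a (w t)) \<in> ?V"
    using \<open>scale (r t) (x t) = _\<close> by (simp add: scale_right_diff_distrib)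
  then show False
    using indep S(4) tS by blast
qed

end

section \<open>Loops in automata\<close>

text \<open>
  Cut a path at its last visit to its initial state \<open>q\<close>: it consists of a loop at \<open>q\<close> and, unless it ends
  there, a letter and a path that avoids \<open>q\<close>.  Induction on the number of states gives a bound that is
  polynomial in the bound \<open>l\<close> for the number of loops.
\<close>

lemma card_words_staying_le:
  fixes \<delta> :: "'s \<Rightarrow> 'n::finite \<Rightarrow> 's"
  assumes "finite S"
    and "\<And>q. q \<in> S \<Longrightarrow> card {w. length w \<le> m \<and> foldl \<delta> q w = q} \<le> l"
  shows "card {w. length w \<le> m \<and> (\<forall>i\<le>length w. foldl \<delta> q (take i w) \<in> S)} \<le> (l * Suc (card (UNIV :: 'n set))) ^ card S"
  using assms
proof (induction "card S" arbitrary: S q)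
  case 0
  then have "{w. length w \<le> m \<and> (\<forall>i\<le>length w. foldl \<delta> q (take i w) \<in> S)} = {}"
    by auto
  then show ?case by (simp only: card.empty)
next
  case (Suc k)
  define stay where "stay S q = {w. length w \<le> m \<and> (\<forall>i\<le>length w. foldl \<delta> q (take i w) \<in> S)}" for S q
  have fin_le: "finite {w :: 'n list. length w \<le> m}"
    using finite_lists_length_le[of "UNIV :: 'n set" m] by simp
  show ?case
  proof (cases "q \<in> S")
    case False
    then have "stay S q = {}"
      by (auto simp: stay_def intro!: exI[of _ 0])
    then show ?thesis
      unfolding stay_def by (simp only: card.empty)
  next
    case True
    define X where "X = (l * Suc (card (UNIV :: 'n set))) ^ k"
    define Loops where "Loops = {w. length w \<le> m \<and> foldl \<delta> q w = q}"
    define Tails where "Tails = (SIGMA x:UNIV. stay (S - {q}) (\<delta> q x))"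
    have fin: "finite Loops" "finite Tails"
      using fin_le by (auto simp: Loops_def Tails_def stay_def intro!: finite_SigmaI elim: rev_finite_subset)
    have Loops: "card Loops \<le> l"
      using Suc.prems(2)[OF True] by (simp add: Loops_def)
    have "card (S - {q}) = k"
      using True Suc.hyps(2) Suc.prems(1) by simp
    then have "card (stay (S - {q}) (\<delta> q x)) \<le> X" for x
      using Suc.hyps(1)[of "S - {q}" "\<delta> q x"] Suc.prems by (simp add: stay_def X_def)
    then have "(\<Sum>x\<in>UNIV. card (stay (S - {q}) (\<delta> q x))) \<le> (\<Sum>x\<in>(UNIV :: 'n set). X)"
      by (intro sum_mono)
    then have Tails: "card Tails \<le> card (UNIV :: 'n set) * X"
      using fin_le by (simp add: Tails_def stay_def card_SigmaI rev_finite_subset)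
    have "stay S q \<subseteq> Loops \<union> (\<lambda>(u, x, v). u @ x # v) ` (Loops \<times> Tails)"
    proof
      fix w
      assume w: "w \<in> stay S q"
      define I where "I = {i. i \<le> length w \<and> foldl \<delta> q (take i w) = q}"
      have I: "finite I" "0 \<in> I"
        by (simp_all add: I_def)
      define i where "i = Max I"
      have "i \<in> I"
        unfolding i_def using I by (intro Max_in) auto
      then have i: "i \<le> length w" "foldl \<delta> q (take i w) = q"
        by (simp_all add: I_def)
      show "w \<in> Loops \<union> (\<lambda>(u, x, v). u @ x # v) ` (Loops \<times> Tails)"
      proof (cases "i = length w")
        case True
        then show ?thesis
          using i w by (simp add: Loops_def stay_def)
      next
        case False
        define x v where "x = w ! i" and "v = drop (Suc i) w"
        have w_eq: "w = take i w @ x # v"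
          using False i(1) by (simp add: x_def v_def id_take_nth_drop)
        have "foldl \<delta> (\<delta> q x) (take j v) \<in> S - {q}" if j: "j \<le> length v" for j
        proof -
          have le: "i + Suc j \<le> length w"
            using j False i(1) by (simp add: v_def)
          have "take (i + Suc j) w = take i w @ x # take j v"
            using False i(1) by (simp add: x_def v_def take_add Cons_nth_drop_Suc[symmetric] del: add_Suc_right)
          then have "foldl \<delta> (\<delta> q x) (take j v) = foldl \<delta> q (take (i + Suc j) w)"
            by (simp add: i(2))
          moreover have "i + Suc j \<notin> I"
            using Max_ge[OF I(1), of "i + Suc j"] by (auto simp: i_def)
          ultimately show ?thesis
            using w le by (simp add: stay_def I_def)
        qed
        then have "(take i w, x, v) \<in> Loops \<times> Tails"
          using w i by (auto simp: Loops_def Tails_def stay_def v_def)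
        then show ?thesis
          using w_eq by (intro UnI2 image_eqI[of _ _ "(take i w, x, v)"]) simp_all
      qed
    qed
    then have "card (stay S q) \<le> card (Loops \<union> (\<lambda>(u, x, v). u @ x # v) ` (Loops \<times> Tails))"
      using fin by (intro card_mono) auto
    also have "\<dots> \<le> card Loops + card (Loops \<times> Tails)"
      using fin by (intro order_trans[OF card_Un_le] add_left_mono card_image_le) auto
    also have "\<dots> \<le> l + l * (card (UNIV :: 'n set) * X)"
      using Loops Tails by (simp add: card_cartesian_product add_mono mult_mono)
    also have "\<dots> \<le> (l * Suc (card (UNIV :: 'n set))) ^ Suc k"
    proof (cases "l = 0")
      case False
      then have "1 \<le> X"
        by (simp add: X_def)
      then have "l * 1 \<le> l * X"
        by (intro mult_left_mono) auto
      then show ?thesis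
        by (simp add: X_def algebra_simps)
    qed simp
    finally show ?thesis
      using Suc.hyps(2) by (simp add: stay_def)
  qed
qed

lemma not_eventually_power_le_polynomial:
  fixes c :: real
  assumes "1 < c" "0 < D"
  shows "\<not> (\<forall>\<^sub>F m in sequentially. c ^ m \<le> D * real (Suc m) ^ k)"
proof
  assume ev: "\<forall>\<^sub>F m in sequentially. c ^ m \<le> D * real (Suc m) ^ k"
  have ln: "0 < ln c"
    using assms by simp
  define \<epsilon> where "\<epsilon> = ln c ^ k / (c * D)"
  have "filterlim (\<lambda>m. real (Suc m) * ln c) at_top sequentially"
    using ln by (intro filterlim_at_top_mult_tendsto_pos[of _ "ln c"] tendsto_const
        filterlim_compose[OF filterlim_real_sequentially filterlim_Suc]) (simp_all add: mult.commute)
  from filterlim_compose[OF tendsto_power_div_exp_0 this]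
  have "(\<lambda>m. (real (Suc m) * ln c) ^ k / exp (real (Suc m) * ln c)) \<longlonglongrightarrow> 0" .
  moreover have "0 < \<epsilon>"
    using assms ln by (simp add: \<epsilon>_def)
  ultimately have "\<forall>\<^sub>F m in sequentially. (real (Suc m) * ln c) ^ k / exp (real (Suc m) * ln c) < \<epsilon>"
    by (rule order_tendstoD(2))
  from eventually_happens'[OF _ eventually_conj[OF ev this]] obtain m where
    m: "c ^ m \<le> D * real (Suc m) ^ k" "(real (Suc m) * ln c) ^ k / exp (real (Suc m) * ln c) < \<epsilon>"
    by auto
  have "exp (real (Suc m) * ln c) = c ^ Suc m"
    unfolding exp_of_nat_mult using assms by simp
  then have "real (Suc m) ^ k * ln c ^ k < \<epsilon> * c ^ Suc m"
    using m(2) assms by (simp add: power_mult_distrib divide_simps)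
  also have "\<epsilon> * c ^ Suc m = ln c ^ k * c ^ m / D"
    using assms by (simp add: \<epsilon>_def)
  also have "\<dots> \<le> ln c ^ k * (D * real (Suc m) ^ k) / D"
    using assms ln m(1) by (intro divide_right_mono mult_left_mono) auto
  finally show False
    using assms by (simp add: mult.commute)
qed

text \<open>
  Otherwise, each state on an accepting path would have at most one loop of each length that is a
  maximal rotation.  Every loop at such a state is a rotation of a loop of this kind, at a state which it
  passes, and is therefore determined by that state, its length, and the amount of rotation.  So the number of loops,
  and with it the number of accepted words, would grow polynomially.
\<close>

lemma exponential_language_has_two_loops:
  fixes \<delta> :: "'s \<Rightarrow> 'n::finite \<Rightarrow> 's"
  assumes digits: "digits c B"
    and Q: "finite Q" "q\<^sub>0 \<in> Q" "\<forall>q\<in>Q. \<forall>i. \<delta> q i \<in> Q"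
    and b: "1 < b"
    and growth: "\<forall>\<^sub>F m in sequentially. b ^ m \<le> real (card {w. foldl \<delta> q\<^sub>0 w \<in> F \<and> length w \<le> m})"
  shows "\<exists>q p s u v. foldl \<delta> q\<^sub>0 p = q \<and> foldl \<delta> q s \<in> F \<and> foldl \<delta> q u = q \<and> foldl \<delta> q v = q \<and>
    digits.max_rotation c B u \<and> digits.max_rotation c B v \<and> u \<noteq> v \<and> length u = length v"
proof (rule ccontr)
  interpret digits c B by (rule digits)
  \<comment> \<open>States through which some accepting path from \<open>q\<^sub>0\<close> passes.\<close>
  define live where "live q \<longleftrightarrow> (\<exists>p. foldl \<delta> q\<^sub>0 p = q) \<and> (\<exists>s. foldl \<delta> q s \<in> F)" for q
  assume "\<not> ?thesis"
  then have unique: "u = v"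
    if "live q" "length u = length v" "foldl \<delta> q u = q" "foldl \<delta> q v = q" "max_rotation u" "max_rotation v"
    for q u v
    using that unfolding live_def by blast
  have run_Q: "q \<in> Q \<Longrightarrow> foldl \<delta> q w \<in> Q" for q w
    using Q(3) by (induction w arbitrary: q) auto
  have live_Q: "live q \<Longrightarrow> q \<in> Q" for q
    using run_Q[OF Q(2)] by (auto simp: live_def)
  define l where "l m = Suc m * (Suc m * card Q)" for m
  have loops: "card {w. length w \<le> m \<and> foldl \<delta> q w = q} \<le> l m" if q: "live q" for q m
  proof -
    define h where "h = (\<lambda>(n, r, q'). rotate r (THE u. length u = n \<and> foldl \<delta> q' u = q' \<and> max_rotation u))"
    have "{w. length w \<le> m \<and> foldl \<delta> q w = q} \<subseteq> h ` ({..m} \<times> {..m} \<times> Q)"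
    proof safe
      fix w
      assume w: "length w \<le> m" "foldl \<delta> q w = q"
      obtain i where i: "i \<le> length w" "max_rotation (rotate i w)"
        by (rule ex_max_rotation)
      define j where "j = i mod length w"
      define q' where "q' = foldl \<delta> q (take j w)"
      have q'_q: "foldl \<delta> q' (drop j w) = q"
        unfolding q'_def using w(2) by (metis append_take_drop_id foldl_append)
      then have loop: "foldl \<delta> q' (rotate i w) = q'"
        unfolding rotate_drop_take by (simp add: j_def[symmetric]) (simp add: q'_def)
      obtain p s where "foldl \<delta> q\<^sub>0 p = q" "foldl \<delta> q s \<in> F"
        using q by (auto simp: live_def)
      then have "foldl \<delta> q\<^sub>0 (p @ take j w) = q'" "foldl \<delta> q' (drop j w @ s) \<in> F"
        using q'_q by (simp_all add: q'_def)
      then have live: "live q'"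
        unfolding live_def by blast
      have "(THE u. length u = length w \<and> foldl \<delta> q' u = q' \<and> max_rotation u) = rotate i w"
        using unique[OF live] loop i(2) by (intro the_equality) auto
      then have "h (length w, length w - i, q') = rotate (length w - i) (rotate i w)"
        by (simp add: h_def)
      also have "\<dots> = w"
        using i(1) by (simp add: rotate_rotate)
      finally show "w \<in> h ` ({..m} \<times> {..m} \<times> Q)"
        using w(1) live_Q[OF live] by (intro image_eqI[of _ _ "(length w, length w - i, q')"]) auto
    qed
    then have "card {w. length w \<le> m \<and> foldl \<delta> q w = q} \<le> card ({..m} \<times> {..m} \<times> Q)"
      using Q(1) by (meson card_image_le card_mono finite_SigmaI finite_atMost finite_imageI order_trans)
    then show ?thesis
      by (simp add: l_def card_cartesian_product)
  qed
  define K where "K = card Q * Suc (card (UNIV :: 'n set))"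
  define N where "N = card (Collect live)"
  have fin_live: "finite (Collect live)"
    using Q(1) live_Q by (auto intro: rev_finite_subset)
  have poly: "card {w. foldl \<delta> q\<^sub>0 w \<in> F \<and> length w \<le> m} \<le> K ^ N * Suc m ^ (2 * N)" for m
  proof -
    have "foldl \<delta> q\<^sub>0 (take i w) \<in> Collect live" if "foldl \<delta> q\<^sub>0 w \<in> F" for w i
      using that unfolding live_def by (metis (mono_tags, lifting) append_take_drop_id foldl_append mem_Collect_eq)
    then have "{w. foldl \<delta> q\<^sub>0 w \<in> F \<and> length w \<le> m} \<subseteq>
        {w. length w \<le> m \<and> (\<forall>i\<le>length w. foldl \<delta> q\<^sub>0 (take i w) \<in> Collect live)}"
      by blast
    moreover have "finite {w :: 'n list. length w \<le> m}"
      using finite_lists_length_le[of "UNIV :: 'n set" m] by simp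
    ultimately have "card {w. foldl \<delta> q\<^sub>0 w \<in> F \<and> length w \<le> m} \<le>
        card {w. length w \<le> m \<and> (\<forall>i\<le>length w. foldl \<delta> q\<^sub>0 (take i w) \<in> Collect live)}"
      by (intro card_mono) (auto elim: rev_finite_subset)
    also have "\<dots> \<le> (l m * Suc (card (UNIV :: 'n set))) ^ N"
      unfolding N_def by (rule card_words_staying_le[OF fin_live]) (use loops in simp)
    also have "l m * Suc (card (UNIV :: 'n set)) = K * Suc m ^ 2"
      unfolding l_def K_def power2_eq_square by (simp only: mult_ac)
    also have "(K * Suc m ^ 2) ^ N = K ^ N * Suc m ^ (2 * N)"
      by (simp add: power_mult_distrib power_mult)
    finally show ?thesis .
  qed
  have "0 < K"
    using Q(1,2) by (auto simp: K_def card_gt_0_iff)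
  moreover have "\<forall>\<^sub>F m in sequentially. b ^ m \<le> real (K ^ N) * real (Suc m) ^ (2 * N)"
    using growth
  proof eventually_elim
    case (elim m)
    then show ?case
      using of_nat_mono[OF poly[of m], where ?'a = real] by simp
  qed
  ultimately show False
    using not_eventually_power_le_polynomial[OF b, of "real (K ^ N)" "2 * N"] by simp
qed

section \<open>Free Lie subalgebras of automata algebras\<close>

lemma is_lie_subalgebra_hull:
  assumes "lie_algebra scale br"
  shows "is_lie_subalgebra scale br (is_lie_subalgebra scale br hull X)"
proof -
  interpret lie_algebra scale br by (rule assms)
  show ?thesis
    unfolding hull_def is_lie_subalgebra_def by (auto intro!: subspace_Inter)
qed

theorem theorem3:
  fixes scale :: "'r::comm_ring_1 \<Rightarrow> 'a::ring \<Rightarrow> 'a"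
    and A :: "'a set"
    and a :: "'n::finite \<Rightarrow> 'a"
  assumes "automata_algebra scale A a"
    and "exponential_growth a"
  shows "\<exists>L (g :: bool \<Rightarrow> 'a).
    L \<subseteq> is_lie_subalgebra scale commutator hull (range a) \<and>
    free_lie_subalgebra scale commutator L g"
proof -
  have monomial: "monomial_algebra scale A a" and regular: "regular_language (nonzero_words a)"
    using assms(1) by (auto simp: automata_algebra_def)
  interpret assoc_algebra scale
    using monomial by (simp add: monomial_algebra_def)
  obtain Q :: "nat set" and \<delta> q\<^sub>0 F where Q: "finite Q" "q\<^sub>0 \<in> Q" "\<forall>q\<in>Q. \<forall>i. \<delta> q i \<in> Q"
    and words: "nonzero_words a = {w. foldl \<delta> q\<^sub>0 w \<in> F}"
    using regular unfolding regular_language_def by blast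
  obtain c :: "'n \<Rightarrow> nat" where c: "bij_betw c UNIV {0..<card (UNIV :: 'n set)}"
    using ex_bij_betw_finite_nat[OF finite] by blast
  define B where "B = Suc (card (UNIV :: 'n set))"
  have "0 < card (UNIV :: 'n set)"
    by (simp add: card_gt_0_iff)
  moreover have "c x < card (UNIV :: 'n set)" for x
    using c by (auto simp: bij_betw_def)
  ultimately have digits: "digits c B"
    using c by unfold_locales (auto simp: B_def bij_betw_def less_Suc_eq)
  interpret digits c B by (rule digits)
  interpret ordered_words scale c B a ..
  obtain b where b: "1 < b" "\<forall>\<^sub>F m in sequentially. b ^ m \<le> real (growth a m)"
    using assms(2) unfolding exponential_growth_def by blast
  then have "\<forall>\<^sub>F m in sequentially. b ^ m \<le> real (card {w. foldl \<delta> q\<^sub>0 w \<in> F \<and> length w \<le> m})"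
    by (simp add: growth_def words)
  from exponential_language_has_two_loops[OF digits Q b(1) this]
  obtain q p s u v where q: "foldl \<delta> q\<^sub>0 p = q" "foldl \<delta> q s \<in> F" and loops: "foldl \<delta> q u = q" "foldl \<delta> q v = q"
    and max: "max_rotation u" "max_rotation v" and uv: "u \<noteq> v" "length u = length v"
    by blast
  have "u \<noteq> []" "v \<noteq> []"
    using uv by auto
  have "slope u \<noteq> slope v"
    using slope_eq_imp_commute[OF \<open>u \<noteq> []\<close> \<open>v \<noteq> []\<close>] uv by auto
  then obtain x y where xy: "max_rotation x" "x \<noteq> []" "max_rotation y" "y \<noteq> []" "slope y < slope x"
    "foldl \<delta> q x = q" "foldl \<delta> q y = q" "length x = length y"
    using max loops uv \<open>u \<noteq> []\<close> \<open>v \<noteq> []\<close> by (metis linorder_neqE_linordered_idom)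
  \<comment> \<open>Both words have length \<open>K\<close>, so products of them are compared letter by letter in base \<open>B ^ K\<close>.\<close>
  define W where "W b = (if b then x @ x @ y else x @ y @ y)" for b
  define K where "K = 3 * length x"
  have length_W: "length (W b) = K" and loop_W: "foldl \<delta> q (W b) = q" for b
    using xy(6-8) by (simp_all add: W_def K_def)
  have K: "0 < K"
    using xy(2) by (simp add: K_def)
  have lyndon_W: "lyndon (W b)" for b
    using lyndon_pair[OF xy(1-5)] by (simp add: W_def)
  have W_neq: "W True \<noteq> W False"
    using xy(5,8) by (auto simp: W_def)
  have W_inj: "b = b'" if "W b = W b'" for b b'
    using that W_neq by (cases b; cases b') auto
  define g where "g b = (SOME z. z \<in> is_lie_subalgebra scale commutator hull (range a) \<and> leads z (W b))" for b
  have g: "g b \<in> is_lie_subalgebra scale commutator hull (range a)" "leads (g b) (W b)" for b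
    using someI_ex[of "\<lambda>z. z \<in> is_lie_subalgebra scale commutator hull (range a) \<and> leads z (W b)"]
      lyndon_leads_lie_element[OF lyndon_W[of b]] unfolding g_def by blast+

  define d where "d b = val (W b)" for b
  have "2 \<le> B ^ K"
    using base K by (metis order_trans self_le_power one_le_numeral)
  \<comment> \<open>Words over \<open>bool\<close>, with the numbers of \<open>W True\<close> and \<open>W False\<close> as digits, have the same slopes as
    the words obtained by substituting \<open>W\<close>.  Hence Hall trees over \<open>bool\<close> keep their leading words.\<close>
  interpret D: digits d "B ^ K"
  proof
    show "inj d"
      using W_inj val_inj length_W by (auto simp: inj_def d_def)
    show "d b < B ^ K" for b
      using val_less[of "W b"] by (simp add: d_def length_W)
  qed fact
  interpret H: lie_hall scale commutator d "B ^ K" g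
    using lie_algebra_commutator by (intro lie_hall.intro D.digits_axioms)
  define subst where "subst = (\<lambda>w. concat (map W w))"
  have subst_append: "subst (w @ w') = subst w @ subst w'" for w w'
    by (simp add: subst_def)
  have length_subst: "length (subst w) = K * length w" for w
    by (induction w) (simp_all add: subst_def length_W)
  have val_subst: "D.val w = val (subst w)" for w
    by (induction w) (simp_all add: subst_def val_append length_subst[unfolded subst_def] power_mult flip: d_def)
  have slope_subst: "D.slope w = slope (subst w)" for w
    by (simp add: D.slope_def slope_def val_subst length_subst power_mult)
  have subst_inj: "w = w'" if "subst w = subst w'" for w w'
  proof (rule D.val_inj)
    show "length w = length w'"
      using arg_cong[OF that, of length] K by (simp add: length_subst)
  qed (simp add: val_subst that)
  have leads: "leads (H.ev t) (subst (foliage t))" if "D.hall t" for t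
    using that
  proof (induction t)
    case (Leaf b)
    then show ?case
      using g(2) by (simp add: subst_def)
  next
    case (Node t t')
    then show ?case
      using D.hall_NodeD[OF Node.prems] leads_commutator by (simp add: subst_append slope_subst)
  qed
  have nonzero: "subst w \<in> nonzero_words a" if "w \<noteq> []" for w
  proof -
    have "foldl \<delta> q (subst w) = q"
      by (induction w) (simp_all add: subst_def loop_W)
    then have "p @ subst w @ s \<in> nonzero_words a"
      using q by (simp add: words)
    moreover have "subst w \<noteq> []"
      using that K length_subst[of w] by auto
    ultimately show ?thesis
      using word_val_factor_nonzero unfolding nonzero_words_def by blast
  qed
  have indep: "\<forall>t\<in>S. r t = 0"
    if S: "finite S" "S \<subseteq> {t. D.hall t}" "(\<Sum>t\<in>S. scale (r t) (H.ev t)) = 0" for S r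
  proof (rule leading_words_independent[where x = H.ev and w = "\<lambda>t. subst (foliage t)"])
    show "inj_on (\<lambda>t. subst (foliage t)) S"
      using S(2) subst_inj D.hall_unique by (intro inj_onI) blast
  qed (use S leads nonzero nonzero_word_independent[OF monomial] in auto)
  define L where "L = is_lie_subalgebra scale commutator hull (range g)"
  have "L \<subseteq> is_lie_subalgebra scale commutator hull (range a)"
    unfolding L_def using g(1) is_lie_subalgebra_hull[OF lie_algebra_commutator]
    by (intro hull_minimal) auto
  moreover have "free_lie_subalgebra scale commutator L g"
    unfolding free_lie_subalgebra_def L_def using H.lie_eq_if_hall_independent[OF indep] by blast
  ultimately show ?thesis
    by blast
qed

end
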